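(* In the multi-term composite minimization setting of the context, assume B1, B2, C and that $\rho_k\ge G_k+H_k$ for $1\le k\le K$. Apply to the saddle point problem $\min_{x^1\in X_1}\max_{x^2\in X_2}\Phi(x^1,x^2)$ the Composite Mirror Prox algorithm described in the context, with starting point $x_1=[u_1;v_1]\in X$ and stepsizes $\gamma_\tau\ge 1/L$ satisfying $\delta_\tau\le0$ for all $\tau$ (as is the case for $\gamma_\tau\equiv1/L$), where $L>0$ is the Lipschitz constant of $F_u$ induced by $\|\cdot\|$, and let $x^t=[x^{1,t};x^{2,t}]$, $t=1,2,\dots$, be the resulting approximate solutions. Let $\widehat x^{1,t}$ be the correction of $x^{1,t}$ and $y^0(\widehat x^{1,t})$ its $y^0$-component. Then $y^0(\widehat x^{1,t})$ is a feasible solution to the problem $$\mathrm{Opt}=\min_{y^0\in Y_0}\Big\{f(y^0):=\sum_{k=0}^K[\psi_k(A_ky^0+b_k)+\Psi_k(A_ky^0+b_k)]\Big\}$$ and $$f(y^0(\widehat x^{1,t}))-\mathrm{Opt}\le\frac{\Theta[\{x^1_*\}\times X_2]\,L}{t},\qquad t=1,2,\dots,$$ where $x^1_*$ is an optimal solution to $\min_{x^1\in X_1}\overline\Phi(x^1)$, $\overline\Phi(x^1)=\sup_{x^2\in X_2}\Phi(x^1,x^2)$, and $\Theta[X']=\sup_{[u;v]\in X'}V_{u_1}(u)$.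
   Context: Setting. $K$ is a nonnegative integer. For $0\le k\le K$: $E_k,\overline E_k$ are Euclidean spaces with nonempty closed convex subsets $Y_k\subset E_k$, $Z_k\subset\overline E_k$; $p_k(\cdot)$ is a norm on $E_k$ and $q_k(\cdot)$ a norm on $\overline E_k$, and $Y_k$, $Z_k$ are equipped with continuously differentiable convex functions $\omega_k:Y_k\to\mathbf R$, $\overline\omega_k:Z_k\to\mathbf R$, strongly convex with modulus 1 w.r.t. $p_k$, $q_k$, respectively; $y^0\mapsto A_ky^0+b_k:E_0\to E_k$ are affine mappings, the one with $k=0$ being the identity on $E_0$; $\psi_k:Y_k\to\mathbf R$ are Lipschitz continuous convex functions with saddle point representations $\psi_k(y^k)=\sup_{z^k\in Z_k}[\phi_k(y^k,z^k)-\overline\Psi_k(z^k)]$, where $\phi_k:Y_k\times Z_k\to\mathbf R$ are smooth (with Lipschitz continuous gradients), convex in $y^k$ and concave in $z^k$, and $\overline\Psi_k:Z_k\to\mathbf R$ are Lipschitz continuous convex; $\Psi_k:Y_k\to\mathbf R$ are Lipschitz continuous convex. For $1\le k\le K$, $\pi_k^*(\cdot)$ is a norm on $E_k$ with conjugate norm $\pi_k(\cdot)$, $W_k=\{w^k\in E_k:\pi_k(w^k)\le1\}$, $\widehat\omega_k:W_k\to\mathbf R$ is continuously differentiable and strongly convex with modulus 1 w.r.t. $\pi_k$, and $\rho_k>0$. Sets: $Y_k^+=\{[y^k;\tau^k]:y^k\in Y_k,\ \tau^k\ge\Psi_k(y^k)\}$, $Z_k^+=\{[z^k;\sigma^k]:z^k\in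 Z_k,\ \sigma^k\ge\overline\Psi_k(z^k)\}$, $0\le k\le K$; $X_1=Y_0^+\times\cdots\times Y_K^+$, $X_2=Z_0^+\times\cdots\times Z_K^+\times W_1\times\cdots\times W_K$. For $x^1=\{[y^k;\tau^k]\}_{k=0}^K\in X_1$, $x^2=[\{[z^k;\sigma^k]\}_{k=0}^K;\{w^k\}_{k=1}^K]\in X_2$, $$\Phi(x^1,x^2)=\sum_{k=0}^K[\phi_k(y^k,z^k)+\tau^k-\sigma^k]+\sum_{k=1}^K\rho_k\langle w^k,y^k-A_ky^0-b_k\rangle.$$ Assumptions. B1: $A_kY_0+b_k\subset Y_k$, $1\le k\le K$. B2: the $Z_k$ are bounded, the $\Psi_k$ are bounded below on $Y_k$, and $f_k=\psi_k+\Psi_k$ are coercive on $Y_k$ ($f_k(y^k_t)\to\infty$ whenever $y^k_t\in Y_k$ and $p_k(y^k_t)\to\infty$), $0\le k\le K$. C: for $1\le k\le K$, $\psi_k$ and $\Psi_k$ are Lipschitz continuous on $Y_k$ w.r.t. $\pi_k^*(\cdot)$ with constants $G_k$ and $H_k$, respectively. Algorithm. Collect the variables as $u=[y^0;\dots;y^K;z^0;\dots;z^K;w^1;\dots;w^K]$ and $v=[\tau^0;\dots;\tau^K;\sigma^0;\dots;\sigma^K]$; let $U$ be the set of all $u$ with $y^k\in Y_k$, $z^k\in Z_k$, $w^k\in W_k$, and $X$ the set of all $[u;v]$ with $u\in U$, $\tau^k\ge\Psi_k(y^k)$, $\sigma^k\ge\overline\Psi_k(z^k)$; $X$ is identified with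 $X_1\times X_2$ by regrouping coordinates. The monotone operator is $F([u;v])=[F_u(u);F_v]$ with $F_v=[1;\dots;1]$ and $F_u(u)$ having blocks: $\nabla_y\phi_0(y^0,z^0)-\sum_{k=1}^K\rho_kA_k^Tw^k$ ($y^0$-block; here $A_k$ is the linear part); $\nabla_y\phi_k(y^k,z^k)+\rho_kw^k$ ($y^k$-block, $1\le k\le K$); $-\nabla_z\phi_k(y^k,z^k)$ ($z^k$-block, $0\le k\le K$); $-\rho_k[y^k-A_ky^0-b_k]$ ($w^k$-block, $1\le k\le K$). With fixed positive reals $\alpha_k,\beta_k$ ($0\le k\le K$), $\gamma^{(k)}$ ($1\le k\le K$), set $$\|u\|=\sqrt{\sum_{k=0}^K[\alpha_kp_k^2(y^k)+\beta_kq_k^2(z^k)]+\sum_{k=1}^K\gamma^{(k)}\pi_k^2(w^k)},$$ $$\omega(u)=\sum_{k=0}^K[\alpha_k\omega_k(y^k)+\beta_k\overline\omega_k(z^k)]+\sum_{k=1}^K\gamma^{(k)}\widehat\omega_k(w^k),$$ $V_u(s)=\omega(s)-\omega(u)-\langle\omega'(u),s-u\rangle$; $L$ is such that $\|F_u(u)-F_u(u')\|_*\le L\|u-u'\|$ on $U$, $\|\cdot\|_*$ being the conjugate norm. For $\xi=[\eta;\zeta]$ and $x=[u;v]\in X$, $P_x(\xi)\in\operatorname{Argmin}_{[s;w]\in X}\{\langle\eta,s\rangle+\langle\zeta,w\rangle+V_u(s)\}$. The algorithm is: $x_1=[u_1;v_1]\in X$, $y_\tau=[u'_\tau;v'_\tau]=P_{x_\tau}(\gamma_\tau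 F(x_\tau))$, $x_{\tau+1}=[u_{\tau+1};v_{\tau+1}]=P_{x_\tau}(\gamma_\tau F(y_\tau))$, $x^t=\big(\sum_{\tau=1}^t\gamma_\tau\big)^{-1}\sum_{\tau=1}^t\gamma_\tau y_\tau$, and $\delta_\tau=\gamma_\tau\langle F_u(u'_\tau)-F_u(u_\tau),u'_\tau-u_{\tau+1}\rangle-V_{u'_\tau}(u_{\tau+1})-V_{u_\tau}(u'_\tau)$. Correction: for $\overline x^1=\{[\overline y^k;\overline\tau^k]\}_{k=0}^K\in X_1$ the correction is $\widehat x^1=\{[\widehat y^k;\widehat\tau^k]\}_{k=0}^K$ with $\widehat y^0=\overline y^0$, $\widehat y^k=A_k\overline y^0+b_k$ ($1\le k\le K$), $\widehat\tau^k=\Psi_k(\widehat y^k)$ ($0\le k\le K$). *)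

theory Defs
  imports "HOL-Analysis.Analysis"
begin

section \<open>Norms, smoothness and strong convexity on subsets of a Euclidean space\<close>

definition norm_on :: "'a::real_vector set \<Rightarrow> ('a \<Rightarrow> real) \<Rightarrow> bool" where
  "norm_on S p \<longleftrightarrow>
     (\<forall>x\<in>S. 0 \<le> p x \<and> (p x = 0 \<longleftrightarrow> x = 0)) \<and>
     (\<forall>x\<in>S. \<forall>c. p (c *\<^sub>R x) = \<bar>c\<bar> * p x) \<and>
     (\<forall>x\<in>S. \<forall>y\<in>S. p (x + y) \<le> p x + p y)"

definition conj_norm :: "'a::real_inner set \<Rightarrow> ('a \<Rightarrow> real) \<Rightarrow> 'a \<Rightarrow> real" where
  "conj_norm S p \<xi> = (SUP x\<in>{x \<in> S. p x \<le> 1}. \<xi> \<bullet> x)"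

text \<open>
  \<open>C1_on S D f g\<close>: the function \<open>f\<close> is continuously differentiable on \<open>D\<close>, a subset of the
  space \<open>S\<close>, with gradient field \<open>g\<close>. When \<open>D\<close> does not span \<open>S\<close> affinely, the gradient is
  determined only along the directions of \<open>D\<close>; hence the gradient field is carried explicitly.
\<close>

definition C1_on ::
  "'a::real_inner set \<Rightarrow> 'a set \<Rightarrow> ('a \<Rightarrow> real) \<Rightarrow> ('a \<Rightarrow> 'a) \<Rightarrow> bool" where
  "C1_on S D f g \<longleftrightarrow>
     (\<forall>x\<in>D. g x \<in> S \<and> (f has_derivative (\<lambda>h. g x \<bullet> h)) (at x within D)) \<and>
     continuous_on D g"

definition strongly_convex_on ::
  "('a::real_vector \<Rightarrow> real) \<Rightarrow> 'a set \<Rightarrow> ('a \<Rightarrow> real) \<Rightarrow> bool" where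
  "strongly_convex_on p D f \<longleftrightarrow> convex D \<and>
     (\<forall>x\<in>D. \<forall>y\<in>D. \<forall>c\<in>{0..1}.
        f ((1 - c) *\<^sub>R x + c *\<^sub>R y)
          \<le> (1 - c) * f x + c * f y - (1 / 2) * c * (1 - c) * (p (x - y))\<^sup>2)"

section \<open>Problem data\<close>

text \<open>
  The spaces \<open>E\<^sub>k\<close> (\<open>Esp\<close>) are linear subspaces of one Euclidean space \<open>'a\<close>, and the spaces
  of the variables \<open>z\<^sup>k\<close> (\<open>EZsp\<close>) are linear subspaces of one Euclidean space \<open>'b\<close>. Every finite
  family of Euclidean spaces of arbitrary dimensions is of this form up to isometry. All families
  are indexed by natural numbers, and only the indices \<open>0..K\<close> (or \<open>1..K\<close>) are ever used.

  \<open>psi\<close>, \<open>PsiY\<close>, \<open>PsiZ\<close> are the functions \<open>\<psi>\<^sub>k\<close>, \<open>\<Psi>\<^sub>k\<close> and \<open>\<Psi>\<^sub>k\<close> overlined; \<open>omY\<close>, \<open>omZ\<close>, \<open>omW\<close> are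
  \<open>\<omega>\<^sub>k\<close>, \<open>\<omega>\<^sub>k\<close> overlined and \<open>\<omega>\<^sub>k\<close> with a hat; names starting with \<open>g\<close> are gradients.
  \<open>pistar\<close> is \<open>\<pi>\<^sub>k\<^sup>*\<close>. \<open>wtY\<close>, \<open>wtZ\<close>, \<open>wtW\<close> are the weights \<open>\<alpha>\<^sub>k\<close>, \<open>\<beta>\<^sub>k\<close>, \<open>\<gamma>\<^sup>(\<^sup>k\<^sup>)\<close>.
\<close>

record ('a, 'b) mt_data =
  Knum :: nat
  Esp :: "nat \<Rightarrow> 'a set"
  EZsp :: "nat \<Rightarrow> 'b set"
  Yset :: "nat \<Rightarrow> 'a set"
  Zset :: "nat \<Rightarrow> 'b set"
  pnorm :: "nat \<Rightarrow> 'a \<Rightarrow> real"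
  qnorm :: "nat \<Rightarrow> 'b \<Rightarrow> real"
  omY :: "nat \<Rightarrow> 'a \<Rightarrow> real"
  gomY :: "nat \<Rightarrow> 'a \<Rightarrow> 'a"
  omZ :: "nat \<Rightarrow> 'b \<Rightarrow> real"
  gomZ :: "nat \<Rightarrow> 'b \<Rightarrow> 'b"
  Amap :: "nat \<Rightarrow> 'a \<Rightarrow> 'a"
  bvec :: "nat \<Rightarrow> 'a"
  psi :: "nat \<Rightarrow> 'a \<Rightarrow> real"
  phi :: "nat \<Rightarrow> 'a \<Rightarrow> 'b \<Rightarrow> real"
  gphiY :: "nat \<Rightarrow> 'a \<Rightarrow> 'b \<Rightarrow> 'a"
  gphiZ :: "nat \<Rightarrow> 'a \<Rightarrow> 'b \<Rightarrow> 'b"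
  PsiY :: "nat \<Rightarrow> 'a \<Rightarrow> real"
  PsiZ :: "nat \<Rightarrow> 'b \<Rightarrow> real"
  pistar :: "nat \<Rightarrow> 'a \<Rightarrow> real"
  omW :: "nat \<Rightarrow> 'a \<Rightarrow> real"
  gomW :: "nat \<Rightarrow> 'a \<Rightarrow> 'a"
  rho :: "nat \<Rightarrow> real"
  wtY :: "nat \<Rightarrow> real"
  wtZ :: "nat \<Rightarrow> real"
  wtW :: "nat \<Rightarrow> real"

definition pinorm :: "('a::real_inner, 'b) mt_data \<Rightarrow> nat \<Rightarrow> 'a \<Rightarrow> real" where
  "pinorm P k = conj_norm (Esp P k) (pistar P k)"

definition Wset :: "('a::real_inner, 'b) mt_data \<Rightarrow> nat \<Rightarrow> 'a set" where
  "Wset P k = {w \<in> Esp P k. pinorm P k w \<le> 1}"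

text \<open>
  \<open>Amap P k\<close> is an arbitrary linear extension to \<open>'a\<close> of the linear part \<open>A\<^sub>k\<close>, which is a map
  from \<open>E\<^sub>0\<close> to \<open>E\<^sub>k\<close>.
\<close>

definition mt_setting :: "('a::euclidean_space, 'b::euclidean_space) mt_data \<Rightarrow> bool" where
  "mt_setting P \<longleftrightarrow>
    (\<forall>k\<le>Knum P.
       subspace (Esp P k) \<and> subspace (EZsp P k) \<and>
       Yset P k \<noteq> {} \<and> closed (Yset P k) \<and> convex (Yset P k) \<and> Yset P k \<subseteq> Esp P k \<and>
       Zset P k \<noteq> {} \<and> closed (Zset P k) \<and> convex (Zset P k) \<and> Zset P k \<subseteq> EZsp P k \<and>
       norm_on (Esp P k) (pnorm P k) \<and> norm_on (EZsp P k) (qnorm P k) \<and>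
       C1_on (Esp P k) (Yset P k) (omY P k) (gomY P k) \<and>
       strongly_convex_on (pnorm P k) (Yset P k) (omY P k) \<and>
       C1_on (EZsp P k) (Zset P k) (omZ P k) (gomZ P k) \<and>
       strongly_convex_on (qnorm P k) (Zset P k) (omZ P k) \<and>
       linear (Amap P k) \<and> Amap P k ` Esp P 0 \<subseteq> Esp P k \<and> bvec P k \<in> Esp P k \<and>
       convex_on (Yset P k) (psi P k) \<and> (\<exists>C. C-lipschitz_on (Yset P k) (psi P k)) \<and>
       (\<forall>y\<in>Yset P k. ereal (psi P k y) = (SUP z\<in>Zset P k. ereal (phi P k y z - PsiZ P k z))) \<and>
       (\<forall>y\<in>Yset P k. \<forall>z\<in>Zset P k.
          gphiY P k y z \<in> Esp P k \<and> gphiZ P k y z \<in> EZsp P k \<and>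
          ((\<lambda>(y, z). phi P k y z) has_derivative
             (\<lambda>(h, g). gphiY P k y z \<bullet> h + gphiZ P k y z \<bullet> g))
            (at (y, z) within Yset P k \<times> Zset P k)) \<and>
       (\<exists>C. C-lipschitz_on (Yset P k \<times> Zset P k) (\<lambda>(y, z). (gphiY P k y z, gphiZ P k y z))) \<and>
       (\<forall>z\<in>Zset P k. convex_on (Yset P k) (\<lambda>y. phi P k y z)) \<and>
       (\<forall>y\<in>Yset P k. concave_on (Zset P k) (\<lambda>z. phi P k y z)) \<and>
       convex_on (Zset P k) (PsiZ P k) \<and> (\<exists>C. C-lipschitz_on (Zset P k) (PsiZ P k)) \<and>
       convex_on (Yset P k) (PsiY P k) \<and> (\<exists>C. C-lipschitz_on (Yset P k) (PsiY P k)) \<and>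
       0 < wtY P k \<and> 0 < wtZ P k) \<and>
    (\<forall>y\<in>Esp P 0. Amap P 0 y + bvec P 0 = y) \<and>
    (\<forall>k\<in>{1..Knum P}.
       norm_on (Esp P k) (pistar P k) \<and>
       C1_on (Esp P k) (Wset P k) (omW P k) (gomW P k) \<and>
       strongly_convex_on (pinorm P k) (Wset P k) (omW P k) \<and>
       0 < rho P k \<and> 0 < wtW P k)"

definition assm_B1 :: "('a::real_vector, 'b) mt_data \<Rightarrow> bool" where
  "assm_B1 P \<longleftrightarrow> (\<forall>k\<in>{1..Knum P}. \<forall>y\<in>Yset P 0. Amap P k y + bvec P k \<in> Yset P k)"

definition assm_B2 :: "('a, 'b::real_normed_vector) mt_data \<Rightarrow> bool" where
  "assm_B2 P \<longleftrightarrow>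
    (\<forall>k\<le>Knum P.
       bounded (Zset P k) \<and>
       bdd_below (PsiY P k ` Yset P k) \<and>
       (\<forall>s :: nat \<Rightarrow> 'a.
          (\<forall>i. s i \<in> Yset P k) \<and> filterlim (\<lambda>i. pnorm P k (s i)) at_top sequentially \<longrightarrow>
          filterlim (\<lambda>i. psi P k (s i) + PsiY P k (s i)) at_top sequentially))"

definition assm_C ::
  "('a::real_vector, 'b) mt_data \<Rightarrow> (nat \<Rightarrow> real) \<Rightarrow> (nat \<Rightarrow> real) \<Rightarrow> bool" where
  "assm_C P G H \<longleftrightarrow>
    (\<forall>k\<in>{1..Knum P}. 0 \<le> G k \<and> 0 \<le> H k \<and>
       (\<forall>y\<in>Yset P k. \<forall>y'\<in>Yset P k.
          \<bar>psi P k y - psi P k y'\<bar> \<le> G k * pistar P k (y - y') \<and>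
          \<bar>PsiY P k y - PsiY P k y'\<bar> \<le> H k * pistar P k (y - y')))"

section \<open>The minimization problem and its saddle point reformulation\<close>

definition fobj :: "('a::real_vector, 'b) mt_data \<Rightarrow> 'a \<Rightarrow> real" where
  "fobj P y = (\<Sum>k\<le>Knum P. psi P k (Amap P k y + bvec P k) + PsiY P k (Amap P k y + bvec P k))"

definition Opt :: "('a::real_vector, 'b) mt_data \<Rightarrow> ereal" where
  "Opt P = (INF y\<in>Yset P 0. ereal (fobj P y))"

text \<open>A point \<open>x1\<close> has \<open>x1 k = (y\<^sup>k, \<tau>\<^sup>k)\<close>; a point of the other player is a pair of the family
  \<open>(z\<^sup>k, \<sigma>\<^sup>k)\<close> and the family \<open>w\<^sup>k\<close>.\<close>

definition X1 :: "('a, 'b) mt_data \<Rightarrow> (nat \<Rightarrow> 'a \<times> real) set" where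
  "X1 P = Pi {..Knum P} (\<lambda>k. {(y, \<tau>). y \<in> Yset P k \<and> PsiY P k y \<le> \<tau>})"

definition X2 :: "('a::real_inner, 'b) mt_data \<Rightarrow> ((nat \<Rightarrow> 'b \<times> real) \<times> (nat \<Rightarrow> 'a)) set" where
  "X2 P = Pi {..Knum P} (\<lambda>k. {(z, \<sigma>). z \<in> Zset P k \<and> PsiZ P k z \<le> \<sigma>})
            \<times> Pi {1..Knum P} (Wset P)"

definition Phi ::
  "('a::real_inner, 'b) mt_data \<Rightarrow> (nat \<Rightarrow> 'a \<times> real) \<Rightarrow>
     ((nat \<Rightarrow> 'b \<times> real) \<times> (nat \<Rightarrow> 'a)) \<Rightarrow> real" where
  "Phi P x1 x2 =
     (\<Sum>k\<le>Knum P. phi P k (fst (x1 k)) (fst (fst x2 k)) + snd (x1 k) - snd (fst x2 k)) +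
     (\<Sum>k=1..Knum P.
        rho P k * (snd x2 k \<bullet> (fst (x1 k) - Amap P k (fst (x1 0)) - bvec P k)))"

definition PhiBar :: "('a::real_inner, 'b) mt_data \<Rightarrow> (nat \<Rightarrow> 'a \<times> real) \<Rightarrow> ereal" where
  "PhiBar P x1 = (SUP x2\<in>X2 P. ereal (Phi P x1 x2))"

definition correction ::
  "('a::real_vector, 'b) mt_data \<Rightarrow> (nat \<Rightarrow> 'a \<times> real) \<Rightarrow> (nat \<Rightarrow> 'a \<times> real)" where
  "correction P x1 = (\<lambda>k.
     let y = (if k = 0 then fst (x1 0) else Amap P k (fst (x1 0)) + bvec P k)
     in (y, PsiY P k y))"

section \<open>Composite Mirror Prox\<close>

text \<open>\<open>u = (y, z, w)\<close> and \<open>v = (\<tau>, \<sigma>)\<close>. Differences of such tuples of families are taken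
  componentwise.\<close>

type_synonym ('a, 'b) upoint = "(nat \<Rightarrow> 'a) \<times> (nat \<Rightarrow> 'b) \<times> (nat \<Rightarrow> 'a)"
type_synonym vpoint = "(nat \<Rightarrow> real) \<times> (nat \<Rightarrow> real)"
type_synonym ('a, 'b) xpoint = "('a, 'b) upoint \<times> vpoint"

definition Uspace :: "('a, 'b) mt_data \<Rightarrow> ('a, 'b) upoint set" where
  "Uspace P = Pi {..Knum P} (Esp P) \<times> Pi {..Knum P} (EZsp P) \<times> Pi {1..Knum P} (Esp P)"

definition Uset :: "('a::real_inner, 'b) mt_data \<Rightarrow> ('a, 'b) upoint set" where
  "Uset P = Pi {..Knum P} (Yset P) \<times> Pi {..Knum P} (Zset P) \<times> Pi {1..Knum P} (Wset P)"

definition Xset :: "('a::real_inner, 'b) mt_data \<Rightarrow> ('a, 'b) xpoint set" where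
  "Xset P = {((y, z, w), (\<tau>, \<sigma>)).
     (y, z, w) \<in> Uset P \<and> (\<forall>k\<le>Knum P. PsiY P k (y k) \<le> \<tau> k \<and> PsiZ P k (z k) \<le> \<sigma> k)}"

fun regroup ::
  "(nat \<Rightarrow> 'a \<times> real) \<times> ((nat \<Rightarrow> 'b \<times> real) \<times> (nat \<Rightarrow> 'a)) \<Rightarrow> ('a, 'b) xpoint" where
  "regroup (x1, (zs, w)) =
     ((\<lambda>k. fst (x1 k), \<lambda>k. fst (zs k), w), (\<lambda>k. snd (x1 k), \<lambda>k. snd (zs k)))"

fun x1_part :: "('a, 'b) xpoint \<Rightarrow> (nat \<Rightarrow> 'a \<times> real)" where
  "x1_part ((y, z, w), (\<tau>, \<sigma>)) = (\<lambda>k. (y k, \<tau> k))"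

fun uinner ::
  "('a, 'b) mt_data \<Rightarrow> ('a::real_inner, 'b::real_inner) upoint \<Rightarrow> ('a, 'b) upoint \<Rightarrow> real" where
  "uinner P (y, z, w) (y', z', w') =
     (\<Sum>k\<le>Knum P. y k \<bullet> y' k + z k \<bullet> z' k) + (\<Sum>k=1..Knum P. w k \<bullet> w' k)"

fun vinner :: "('a, 'b) mt_data \<Rightarrow> vpoint \<Rightarrow> vpoint \<Rightarrow> real" where
  "vinner P (\<tau>, \<sigma>) (\<tau>', \<sigma>') = (\<Sum>k\<le>Knum P. \<tau> k * \<tau>' k + \<sigma> k * \<sigma>' k)"

fun xscale ::
  "real \<Rightarrow> ('a::real_vector, 'b::real_vector) xpoint \<Rightarrow> ('a, 'b) xpoint" where
  "xscale c ((y, z, w), (\<tau>, \<sigma>)) =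
     ((\<lambda>k. c *\<^sub>R y k, \<lambda>k. c *\<^sub>R z k, \<lambda>k. c *\<^sub>R w k), (\<lambda>k. c * \<tau> k, \<lambda>k. c * \<sigma> k))"

fun unorm :: "('a::real_inner, 'b) mt_data \<Rightarrow> ('a, 'b) upoint \<Rightarrow> real" where
  "unorm P (y, z, w) =
     sqrt ((\<Sum>k\<le>Knum P. wtY P k * (pnorm P k (y k))\<^sup>2 + wtZ P k * (qnorm P k (z k))\<^sup>2) +
           (\<Sum>k=1..Knum P. wtW P k * (pinorm P k (w k))\<^sup>2))"

definition unorm_dual ::
  "('a::real_inner, 'b::real_inner) mt_data \<Rightarrow> ('a, 'b) upoint \<Rightarrow> real" where
  "unorm_dual P \<xi> = (SUP h\<in>{h \<in> Uspace P. unorm P h \<le> 1}. uinner P \<xi> h)"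

fun omega :: "('a, 'b) mt_data \<Rightarrow> ('a, 'b) upoint \<Rightarrow> real" where
  "omega P (y, z, w) =
     (\<Sum>k\<le>Knum P. wtY P k * omY P k (y k) + wtZ P k * omZ P k (z k)) +
     (\<Sum>k=1..Knum P. wtW P k * omW P k (w k))"

fun gomega ::
  "('a::real_vector, 'b::real_vector) mt_data \<Rightarrow> ('a, 'b) upoint \<Rightarrow> ('a, 'b) upoint" where
  "gomega P (y, z, w) =
     (\<lambda>k. wtY P k *\<^sub>R gomY P k (y k),
      \<lambda>k. wtZ P k *\<^sub>R gomZ P k (z k),
      \<lambda>k. wtW P k *\<^sub>R gomW P k (w k))"

definition Vdist ::
  "('a::real_inner, 'b::real_inner) mt_data \<Rightarrow> ('a, 'b) upoint \<Rightarrow> ('a, 'b) upoint \<Rightarrow> real" where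
  "Vdist P u s = omega P s - omega P u - uinner P (gomega P u) (s - u)"

definition Theta ::
  "('a::real_inner, 'b::real_inner) mt_data \<Rightarrow> ('a, 'b) upoint \<Rightarrow> ('a, 'b) xpoint set \<Rightarrow> ereal"
  where "Theta P u1 X' = (SUP (u, v)\<in>X'. ereal (Vdist P u1 u))"

text \<open>
  \<open>adjoint (Amap P k)\<close> is the transpose of \<open>A\<^sub>k\<close> up to a component orthogonal to \<open>E\<^sub>0\<close>, which
  depends on the extension of \<open>A\<^sub>k\<close> to \<open>'a\<close> and does not affect any pairing with vectors of
  \<open>Uspace P\<close>.
\<close>

fun Fu :: "('a::euclidean_space, 'b::euclidean_space) mt_data \<Rightarrow> ('a, 'b) upoint \<Rightarrow> ('a, 'b) upoint"
  where
  "Fu P (y, z, w) =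
     (\<lambda>k. if k = 0
           then gphiY P 0 (y 0) (z 0) - (\<Sum>j=1..Knum P. rho P j *\<^sub>R adjoint (Amap P j) (w j))
           else gphiY P k (y k) (z k) + rho P k *\<^sub>R w k,
      \<lambda>k. - gphiZ P k (y k) (z k),
      \<lambda>k. - (rho P k *\<^sub>R (y k - Amap P k (y 0) - bvec P k)))"

definition Fop ::
  "('a::euclidean_space, 'b::euclidean_space) mt_data \<Rightarrow> ('a, 'b) xpoint \<Rightarrow> ('a, 'b) xpoint" where
  "Fop P x = (Fu P (fst x), (\<lambda>k. 1, \<lambda>k. 1))"

definition Fu_lipschitz :: "('a::euclidean_space, 'b::euclidean_space) mt_data \<Rightarrow> real \<Rightarrow> bool" where
  "Fu_lipschitz P L \<longleftrightarrow>
     (\<forall>u\<in>Uset P. \<forall>u'\<in>Uset P. unorm_dual P (Fu P u - Fu P u') \<le> L * unorm P (u - u'))"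

definition is_prox ::
  "('a::real_inner, 'b::real_inner) mt_data \<Rightarrow> ('a, 'b) xpoint \<Rightarrow> ('a, 'b) xpoint \<Rightarrow>
     ('a, 'b) xpoint \<Rightarrow> bool" where
  "is_prox P x \<xi> p \<longleftrightarrow>
     is_arg_min (\<lambda>s. uinner P (fst \<xi>) (fst s) + vinner P (snd \<xi>) (snd s) + Vdist P (fst x) (fst s))
       (\<lambda>s. s \<in> Xset P) p"

definition mirror_prox ::
  "('a::euclidean_space, 'b::euclidean_space) mt_data \<Rightarrow> (nat \<Rightarrow> real) \<Rightarrow>
     (nat \<Rightarrow> ('a, 'b) xpoint) \<Rightarrow> (nat \<Rightarrow> ('a, 'b) xpoint) \<Rightarrow> bool" where
  "mirror_prox P \<gamma> x y \<longleftrightarrow>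
     x 1 \<in> Xset P \<and>
     (\<forall>i\<ge>1. is_prox P (x i) (xscale (\<gamma> i) (Fop P (x i))) (y i) \<and>
            is_prox P (x i) (xscale (\<gamma> i) (Fop P (y i))) (x (Suc i)))"

definition delta ::
  "('a::euclidean_space, 'b::euclidean_space) mt_data \<Rightarrow> (nat \<Rightarrow> real) \<Rightarrow>
     (nat \<Rightarrow> ('a, 'b) xpoint) \<Rightarrow> (nat \<Rightarrow> ('a, 'b) xpoint) \<Rightarrow> nat \<Rightarrow> real" where
  "delta P \<gamma> x y i =
     \<gamma> i * uinner P (Fu P (fst (y i)) - Fu P (fst (x i))) (fst (y i) - fst (x (Suc i)))
     - Vdist P (fst (y i)) (fst (x (Suc i))) - Vdist P (fst (x i)) (fst (y i))"

definition wmean ::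
  "(nat \<Rightarrow> real) \<Rightarrow> (nat \<Rightarrow> nat \<Rightarrow> 'c::real_vector) \<Rightarrow> nat \<Rightarrow> nat \<Rightarrow> 'c" where
  "wmean \<gamma> s t = (\<lambda>k. inverse (\<Sum>i=1..t. \<gamma> i) *\<^sub>R (\<Sum>i=1..t. \<gamma> i *\<^sub>R s i k))"

definition approx_sol ::
  "(nat \<Rightarrow> real) \<Rightarrow> (nat \<Rightarrow> ('a::real_vector, 'b::real_vector) xpoint) \<Rightarrow> nat \<Rightarrow> ('a, 'b) xpoint"
  where
  "approx_sol \<gamma> y t =
     ((wmean \<gamma> (\<lambda>i. fst (fst (y i))) t,
       wmean \<gamma> (\<lambda>i. fst (snd (fst (y i)))) t,
       wmean \<gamma> (\<lambda>i. snd (snd (fst (y i)))) t),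
      (wmean \<gamma> (\<lambda>i. fst (snd (y i))) t,
       wmean \<gamma> (\<lambda>i. snd (snd (y i))) t))"

end

theory Submission
  imports Defs
begin

text \<open>
  The averaged point may violate the coupling constraints \<open>y\<^sup>k = A\<^sub>k y\<^sup>0 + b\<^sub>k\<close>, and the theorem says that
  repairing this costs nothing. The reason is exact penalization: maximizing the saddle point function
  over \<open>w\<^sup>k\<close> charges \<open>\<rho>\<^sub>k \<pi>\<^sub>k\<^sup>*(d\<^sub>k)\<close> for the violation \<open>d\<^sub>k = y\<^sup>k - A\<^sub>k y\<^sup>0 - b\<^sub>k\<close>, whereas by Lipschitz
  continuity moving \<open>y\<^sup>k\<close> to \<open>A\<^sub>k y\<^sup>0 + b\<^sub>k\<close> raises the \<open>k\<close>-th term of the objective by at most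
  \<open>(G\<^sub>k + H\<^sub>k) \<pi>\<^sub>k\<^sup>*(d\<^sub>k)\<close>. Hence \<open>f(y\<^sup>0)\<close> is a lower bound of the primal function at every \<open>x\<^sup>1\<close>
  (\<open>Phi_ge_fobj\<close>, which rests on the norm duality \<open>conj_norm_dual_witness\<close>) and an upper bound of it at the
  corrected point (\<open>Phi_correction_le_fobj\<close>). It follows that the two problems have the same
  optimal value, that a minimizer of \<open>f\<close>, which exists by coercivity, lifts to an optimal \<open>x\<^sup>1\<^sub>*\<close>
  (\<open>PhiBar_attains_inf\<close>), and that the accuracy of the corrected point in terms of \<open>f\<close> is at most that of
  the averaged point in terms of the primal function.

  The latter accuracy is estimated by the usual analysis of Mirror Prox. First-order optimality of a
  prox point gives a three-point inequality for Bregman distances (\<open>prox_three_point\<close>); combining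
  the two prox steps of one iteration bounds \<open>\<gamma>\<^sub>i \<langle>F(y\<^sub>i), y\<^sub>i - s\<rangle>\<close> by a difference of consecutive Bregman
  distances to \<open>s\<close> plus \<open>\<delta>\<^sub>i\<close> (\<open>mirror_prox_step\<close>), and the sum telescopes. By convexity and concavity
  \<open>\<langle>F(p), p - s\<rangle>\<close> dominates the gap \<open>\<Phi>(p\<^sup>1, s\<^sup>2) - \<Phi>(s\<^sup>1, p\<^sup>2)\<close> (\<open>Phi_gap_le_oper_gap\<close>), and by Jensen's inequality
  the averaged gap dominates the gap at the averaged point. Taking \<open>s\<^sup>1 = x\<^sup>1\<^sub>*\<close> fixed and only \<open>s\<^sup>2\<close> variable
  is what reduces the domain of \<open>\<Theta>\<close> to \<open>{x\<^sup>1\<^sub>*} \<times> X\<^sub>2\<close>.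
\<close>

section \<open>Norms on subspaces and their conjugates\<close>

lemma norm_onD:
  assumes "norm_on S p"
  shows norm_on_nonneg: "x \<in> S \<Longrightarrow> 0 \<le> p x"
    and norm_on_eq_0_iff: "x \<in> S \<Longrightarrow> p x = 0 \<longleftrightarrow> x = 0"
    and norm_on_scaleR: "x \<in> S \<Longrightarrow> p (c *\<^sub>R x) = \<bar>c\<bar> * p x"
    and norm_on_triangle: "x \<in> S \<Longrightarrow> y \<in> S \<Longrightarrow> p (x + y) \<le> p x + p y"
  using assms unfolding norm_on_def by blast+

lemma norm_on_le_norm:
  fixes S :: "'a::euclidean_space set"
  assumes S: "subspace S" and p: "norm_on S p"
  obtains C where "0 < C" "\<And>x. x \<in> S \<Longrightarrow> p x \<le> C * norm x"
proof -
  obtain B where B: "B \<subseteq> S" "pairwise orthogonal B" "\<And>b. b \<in> B \<Longrightarrow> norm b = 1"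
    "independent B" "span B = S"
    using orthonormal_basis_subspace[OF S] by metis
  have fin: "finite B"
    using B(4) by (rule independent_imp_finite)
  have sum_le: "p (\<Sum>b\<in>A. c b *\<^sub>R b) \<le> (\<Sum>b\<in>A. \<bar>c b\<bar> * p b)"
    if "finite A" "A \<subseteq> S" for A c
    using that
  proof (induction A)
    case empty
    then show ?case using norm_on_eq_0_iff[OF p subspace_0[OF S]] by simp
  next
    case (insert a A)
    have "p (c a *\<^sub>R a + (\<Sum>b\<in>A. c b *\<^sub>R b)) \<le> p (c a *\<^sub>R a) + p (\<Sum>b\<in>A. c b *\<^sub>R b)"
      using insert.prems by (intro norm_on_triangle[OF p] subspace_scale[OF S] subspace_sum[OF S]) auto
    then show ?case
      using insert norm_on_scaleR[OF p, of a "c a"] by auto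
  qed
  have "p x \<le> ((\<Sum>b\<in>B. p b) + 1) * norm x" if "x \<in> S" for x
  proof -
    have "p x = p (\<Sum>b\<in>B. (x \<bullet> b) *\<^sub>R b)"
      using orthonormal_basis_expand[OF B(2,3) _ fin, of x] B(5) that by simp
    also have "\<dots> \<le> (\<Sum>b\<in>B. \<bar>x \<bullet> b\<bar> * p b)"
      by (rule sum_le[OF fin B(1)])
    also have "\<dots> \<le> (\<Sum>b\<in>B. norm x * p b)"
    proof (intro sum_mono mult_right_mono)
      fix b assume b: "b \<in> B"
      show "\<bar>x \<bullet> b\<bar> \<le> norm x" using Cauchy_Schwarz_ineq2[of x b] B(3)[OF b] by simp
      show "0 \<le> p b" using norm_on_nonneg[OF p] b B(1) by blast
    qed
    finally show ?thesis by (simp add: sum_distrib_left[symmetric] algebra_simps add_increasing)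
  qed
  moreover have "0 < (\<Sum>b\<in>B. p b) + 1"
    using norm_on_nonneg[OF p] B(1) by (intro add_nonneg_pos sum_nonneg) auto
  ultimately show thesis using that by blast
qed

lemma continuous_on_norm_on:
  fixes S :: "'a::euclidean_space set"
  assumes S: "subspace S" and p: "norm_on S p"
  shows "continuous_on S p"
proof -
  obtain C where C: "0 < C" "\<And>x. x \<in> S \<Longrightarrow> p x \<le> C * norm x"
    using norm_on_le_norm[OF S p] by blast
  have "p x - p y \<le> C * norm (x - y)" if "x \<in> S" "y \<in> S" for x y
    using norm_on_triangle[OF p subspace_diff[OF S that] that(2)] C(2)[OF subspace_diff[OF S that]]
    by simp
  then have "C-lipschitz_on S p"
    using C(1) by (intro lipschitz_onI) (auto simp: dist_norm abs_le_iff, metis norm_minus_commute)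
  then show ?thesis by (rule lipschitz_on_continuous_on)
qed

text \<open>The reverse bound of the equivalence of norms: \<open>p\<close> is continuous and so attains a positive
  minimum on the unit sphere of \<open>S\<close>.\<close>

lemma norm_le_norm_on:
  fixes S :: "'a::euclidean_space set"
  assumes S: "subspace S" and p: "norm_on S p"
  obtains C where "0 < C" "\<And>x. x \<in> S \<Longrightarrow> norm x \<le> C * p x"
proof (cases "sphere 0 1 \<inter> S = {}")
  case True
  have "x = 0" if "x \<in> S" for x
  proof (rule ccontr)
    assume "x \<noteq> 0"
    then have "x /\<^sub>R norm x \<in> sphere 0 1 \<inter> S" using that S by (simp add: subspace_scale)
    then show False using True by blast
  qed
  then show thesis using that[of 1] norm_on_nonneg[OF p] by fastforce
next
  case False
  have "compact (sphere 0 1 \<inter> S)"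
    by (intro compact_Int_closed compact_sphere closed_subspace S)
  then obtain a where a: "a \<in> sphere 0 1 \<inter> S" "\<And>x. x \<in> sphere 0 1 \<inter> S \<Longrightarrow> p a \<le> p x"
    using continuous_attains_inf[OF _ False continuous_on_subset[OF continuous_on_norm_on[OF S p]]]
    by auto
  have pos: "0 < p a"
    using a(1) norm_on_nonneg[OF p, of a] norm_on_eq_0_iff[OF p, of a] by fastforce
  have "norm x \<le> (1 / p a) * p x" if "x \<in> S" for x
  proof (cases "x = 0")
    case False
    have "p a \<le> p (inverse (norm x) *\<^sub>R x)"
      using a(2)[of "inverse (norm x) *\<^sub>R x"] False that S by (simp add: subspace_scale)
    also have "\<dots> = p x / norm x"
      using norm_on_scaleR[OF p that] by (simp add: divide_inverse mult.commute)
    finally show ?thesis using False pos by (simp add: field_simps)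
  qed (use norm_on_nonneg[OF p that] pos in simp)
  then show thesis using that[of "1 / p a"] pos by simp
qed

lemma inner_le_weighted_norm:
  fixes S :: "'a::euclidean_space set"
  assumes S: "subspace S" and p: "norm_on S p" and wt: "0 < wt"
  obtains M where "0 \<le> M" "\<And>h. h \<in> S \<Longrightarrow> \<xi> \<bullet> h \<le> M * sqrt (wt * (p h)\<^sup>2)"
proof -
  obtain C where C: "0 < C" "\<And>x. x \<in> S \<Longrightarrow> norm x \<le> C * p x"
    using norm_le_norm_on[OF S p] by blast
  have "\<xi> \<bullet> h \<le> (norm \<xi> * C / sqrt wt) * sqrt (wt * (p h)\<^sup>2)" if "h \<in> S" for h
  proof -
    have "\<xi> \<bullet> h \<le> norm \<xi> * norm h" by (rule norm_cauchy_schwarz)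
    also have "\<dots> \<le> norm \<xi> * (C * p h)" using C(2)[OF that] by (intro mult_left_mono) auto
    finally show ?thesis
      using norm_on_nonneg[OF p that] wt by (simp add: real_sqrt_mult)
  qed
  then show thesis using C(1) wt by (intro that[of "norm \<xi> * C / sqrt wt"]) auto
qed

lemma bdd_above_conj_norm:
  fixes S :: "'a::euclidean_space set"
  assumes "subspace S" "norm_on S p"
  shows "bdd_above ((\<lambda>x. \<xi> \<bullet> x) ` {x \<in> S. p x \<le> 1})"
proof -
  obtain C where C: "0 < C" "\<And>x. x \<in> S \<Longrightarrow> norm x \<le> C * p x"
    using norm_le_norm_on[OF assms] by blast
  have "\<xi> \<bullet> x \<le> norm \<xi> * C" if "x \<in> S" "p x \<le> 1" for x
  proof -
    have "\<xi> \<bullet> x \<le> norm \<xi> * norm x" by (rule norm_cauchy_schwarz)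
    also have "norm x \<le> C"
      using C(2)[OF that(1)] mult_left_mono[OF that(2), of C] C(1) by linarith
    finally show ?thesis by (simp add: mult_left_mono)
  qed
  then show ?thesis by (intro bdd_aboveI2) auto
qed

lemma inner_le_conj_norm:
  fixes S :: "'a::euclidean_space set"
  assumes S: "subspace S" and p: "norm_on S p" and x: "x \<in> S"
  shows "\<xi> \<bullet> x \<le> conj_norm S p \<xi> * p x"
proof (cases "x = 0")
  case True
  then show ?thesis using norm_on_eq_0_iff[OF p x] by simp
next
  case False
  then have pos: "0 < p x" using norm_on_nonneg[OF p x] norm_on_eq_0_iff[OF p x] by simp
  have "\<xi> \<bullet> (inverse (p x) *\<^sub>R x) \<le> conj_norm S p \<xi>"
    unfolding conj_norm_def
    using pos x S norm_on_scaleR[OF p x, of "inverse (p x)"]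
    by (intro cSUP_upper bdd_above_conj_norm[OF S p]) (auto simp: subspace_scale)
  then show ?thesis using pos by (simp add: field_simps)
qed

lemma conj_norm_leI:
  assumes S: "subspace S" and p: "norm_on S p"
    and "\<And>x. x \<in> S \<Longrightarrow> p x \<le> 1 \<Longrightarrow> \<xi> \<bullet> x \<le> c"
  shows "conj_norm S p \<xi> \<le> c"
  unfolding conj_norm_def
  using assms(3) subspace_0[OF S] norm_on_eq_0_iff[OF p subspace_0[OF S]]
  by (intro cSUP_least) auto

lemma conj_norm_nonneg:
  fixes S :: "'a::euclidean_space set"
  assumes S: "subspace S" and p: "norm_on S p"
  shows "0 \<le> conj_norm S p \<xi>"
proof -
  have "\<xi> \<bullet> 0 \<le> conj_norm S p \<xi>"
    unfolding conj_norm_def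
    using subspace_0[OF S] norm_on_eq_0_iff[OF p subspace_0[OF S]]
    by (intro cSUP_upper bdd_above_conj_norm[OF S p]) auto
  then show ?thesis by simp
qed

lemma norm_on_conj_norm:
  fixes S :: "'a::euclidean_space set"
  assumes S: "subspace S" and p: "norm_on S p"
  shows "norm_on S (conj_norm S p)"
proof -
  let ?q = "conj_norm S p"
  note nonneg = conj_norm_nonneg[OF S p]
  have ball: "\<xi> \<bullet> x \<le> ?q \<xi>" if "x \<in> S" "p x \<le> 1" for \<xi> x
    using inner_le_conj_norm[OF S p that(1), of \<xi>] mult_left_mono[OF that(2) nonneg[of \<xi>]] by simp
  have zero: "?q 0 = 0"
    using nonneg[of 0] by (intro antisym conj_norm_leI[OF S p]) auto
  have scale_le: "?q (c *\<^sub>R \<xi>) \<le> \<bar>c\<bar> * ?q \<xi>" for c \<xi>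
  proof (rule conj_norm_leI[OF S p])
    fix x assume x: "x \<in> S" "p x \<le> 1"
    have "(c *\<^sub>R \<xi>) \<bullet> x = \<bar>c\<bar> * (\<xi> \<bullet> (sgn c *\<^sub>R x))"
      by (simp add: abs_mult_sgn[symmetric] mult.assoc)
    also have "\<dots> \<le> \<bar>c\<bar> * ?q \<xi>"
      using x S norm_on_scaleR[OF p x(1), of "sgn c"]
      by (intro mult_left_mono ball) (auto simp: subspace_scale sgn_if)
    finally show "(c *\<^sub>R \<xi>) \<bullet> x \<le> \<bar>c\<bar> * ?q \<xi>" .
  qed
  have scale: "?q (c *\<^sub>R \<xi>) = \<bar>c\<bar> * ?q \<xi>" for c \<xi>
  proof (cases "c = 0")
    case False
    have "\<bar>c\<bar> * ?q \<xi> = \<bar>c\<bar> * ?q (inverse c *\<^sub>R c *\<^sub>R \<xi>)" using False by simp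
    also have "\<dots> \<le> \<bar>c\<bar> * (\<bar>inverse c\<bar> * ?q (c *\<^sub>R \<xi>))"
      by (intro mult_left_mono scale_le) simp
    also have "\<dots> = ?q (c *\<^sub>R \<xi>)" using False by (simp add: field_simps)
    finally show ?thesis using scale_le[of c \<xi>] by simp
  qed (simp add: zero)
  have "?q (\<xi> + \<eta>) \<le> ?q \<xi> + ?q \<eta>" for \<xi> \<eta>
    by (rule conj_norm_leI[OF S p]) (auto simp: inner_add_left intro: add_mono ball)
  moreover have "\<xi> = 0" if "\<xi> \<in> S" "?q \<xi> = 0" for \<xi>
  proof -
    have "\<xi> \<bullet> \<xi> \<le> 0" using inner_le_conj_norm[OF S p that(1), of \<xi>] that(2) by simp
    then show ?thesis by (metis inner_eq_zero_iff inner_ge_zero order_antisym)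
  qed
  ultimately show ?thesis
    unfolding norm_on_def using nonneg scale zero by blast
qed

text \<open>A norm is recovered from its conjugate: a point outside the closed ball \<open>{p \<le> c}\<close> is cut off
  by a hyperplane, and its normal, projected onto \<open>S\<close> and normalized in the conjugate norm, is the
  functional wanted.\<close>

lemma conj_norm_dual_witness:
  fixes S :: "'a::euclidean_space set"
  assumes S: "subspace S" and p: "norm_on S p" and x: "x \<in> S" and c: "c < p x"
  obtains w where "w \<in> S" "conj_norm S p w \<le> 1" "c < w \<bullet> x"
proof (cases "c < 0")
  case True
  moreover have "conj_norm S p 0 = 0"
    using norm_on_eq_0_iff[OF norm_on_conj_norm[OF S p] subspace_0[OF S]] by simp
  ultimately show thesis using that[of 0] subspace_0[OF S] by simp
next
  case False
  let ?B = "{x \<in> S. p x \<le> c}" and ?q = "conj_norm S p"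
  have cvx: "convex ?B"
  proof (rule convexI)
    fix u v :: 'a and a b :: real
    assume uv: "u \<in> ?B" "v \<in> ?B" and ab: "0 \<le> a" "0 \<le> b" "a + b = 1"
    have "p (a *\<^sub>R u + b *\<^sub>R v) \<le> a * p u + b * p v"
      using norm_on_triangle[OF p, of "a *\<^sub>R u" "b *\<^sub>R v"] norm_on_scaleR[OF p, of u a]
        norm_on_scaleR[OF p, of v b] uv ab S by (auto simp: subspace_scale)
    also have "\<dots> \<le> c" using uv ab by (intro convex_bound_le) auto
    finally show "a *\<^sub>R u + b *\<^sub>R v \<in> ?B"
      using uv S by (simp add: subspace_add subspace_scale)
  qed
  have cls: "closed ?B"
    using continuous_on_norm_on[OF S p] closed_subspace[OF S]
    by (rule continuous_closed_preimage[of S p "{..c}", simplified vimage_def Int_def, simplified])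
  have "x \<notin> ?B" using c by simp
  from separating_hyperplane_closed_point[OF cvx cls this]
  obtain a b where ab: "a \<bullet> x < b" "\<And>u. u \<in> ?B \<Longrightarrow> b < a \<bullet> u"
    by auto
  \<comment> \<open>The separating normal \<open>a\<close> need not lie in \<open>S\<close>; only its component \<open>d\<close> along \<open>S\<close> acts there.\<close>
  obtain d e where de: "d \<in> span S" "\<And>w. w \<in> span S \<Longrightarrow> orthogonal e w" "- a = d + e"
    by (rule orthogonal_subspace_decomp_exists[of S "- a"]) blast
  have S': "span S = S" using S by simp
  have d: "d \<in> S" using de(1) S' by simp
  have inner_d: "d \<bullet> u = - (a \<bullet> u)" if "u \<in> S" for u
  proof -
    have "e \<bullet> u = 0" using de(2)[of u] that S' by (simp add: orthogonal_def)
    moreover have "- (a \<bullet> u) = d \<bullet> u + e \<bullet> u" by (metis de(3) inner_add_left inner_minus_left)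
    ultimately show ?thesis by simp
  qed
  have "0 \<in> ?B" using False subspace_0[OF S] norm_on_eq_0_iff[OF p subspace_0[OF S]] by simp
  then have "b < 0" using ab(2)[of 0] by simp
  then have "d \<bullet> x > 0" using ab(1) inner_d[OF x] by simp
  then have pos: "0 < ?q d"
    using conj_norm_nonneg[OF S p, of d] norm_on_eq_0_iff[OF norm_on_conj_norm[OF S p] d] by fastforce
  have "c * ?q d < d \<bullet> x"
  proof (cases "c = 0")
    case False
    with \<open>\<not> c < 0\<close> have "c > 0" by simp
    have "?q d \<le> - b / c"
    proof (rule conj_norm_leI[OF S p])
      fix u assume u: "u \<in> S" "p u \<le> 1"
      have "c *\<^sub>R u \<in> ?B"
        using u S norm_on_scaleR[OF p u(1), of c] \<open>c > 0\<close> by (simp add: subspace_scale)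
      from ab(2)[OF this] show "d \<bullet> u \<le> - b / c"
        using inner_d[OF u(1)] \<open>c > 0\<close> by (simp add: field_simps)
    qed
    then have "c * ?q d \<le> - b" using \<open>c > 0\<close> by (simp add: field_simps)
    then show ?thesis using ab(1) inner_d[OF x] by simp
  qed (use \<open>d \<bullet> x > 0\<close> in simp)
  then have "c < (inverse (?q d) *\<^sub>R d) \<bullet> x" using pos by (simp add: field_simps)
  moreover have "?q (inverse (?q d) *\<^sub>R d) \<le> 1"
    using norm_on_scaleR[OF norm_on_conj_norm[OF S p] d, of "inverse (?q d)"] pos by simp
  ultimately show thesis using that subspace_scale[OF S d] by blast
qed

section \<open>One-sided derivatives along segments\<close>

lemma segment_param: "x + t *\<^sub>R (y - x) = (1 - t) *\<^sub>R x + t *\<^sub>R (y :: 'a::real_vector)"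
  by (simp add: algebra_simps)

lemma segment_in_convex:
  assumes "convex D" "x \<in> D" "y \<in> D" "t \<in> {0..1}"
  shows "x + t *\<^sub>R (y - x) \<in> D"
  using assms by (simp add: segment_param convexD)

lemma segment_derivative:
  fixes f :: "'a::real_inner \<Rightarrow> real"
  assumes D: "convex D" "x \<in> D" "y \<in> D"
    and f: "(f has_derivative (\<lambda>h. g \<bullet> h)) (at x within D)"
  shows "((\<lambda>t. f (x + t *\<^sub>R (y - x))) has_real_derivative g \<bullet> (y - x)) (at 0 within {0..1})"
proof -
  have "((\<lambda>t. x + t *\<^sub>R (y - x)) has_derivative (\<lambda>t. t *\<^sub>R (y - x))) (at 0 within {0..1})"
    by (auto intro!: derivative_eq_intros)
  moreover have "(f has_derivative (\<lambda>h. g \<bullet> h))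
      (at (x + 0 *\<^sub>R (y - x)) within (\<lambda>t. x + t *\<^sub>R (y - x)) ` {0..1})"
  proof -
    have "(\<lambda>t. x + t *\<^sub>R (y - x)) ` {0..1} \<subseteq> D"
      using segment_in_convex[OF D] by blast
    then show ?thesis using has_derivative_subset[OF f] by simp
  qed
  ultimately have "((\<lambda>t. f (x + t *\<^sub>R (y - x))) has_derivative (\<lambda>t. g \<bullet> (t *\<^sub>R (y - x)))) (at 0 within {0..1})"
    by (rule has_derivative_in_compose)
  then show ?thesis by (simp add: has_field_derivative_def mult.commute[of _ "g \<bullet> (y - x)"] mult_commute_abs)
qed

text \<open>Both the gradient inequalities and the optimality condition of a prox point are instances of
  this: all functions live on sets with possibly empty interior, where only derivatives along
  segments into the set make sense.\<close>

lemma derivative_nonneg_at_left_min: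
  fixes h :: "real \<Rightarrow> real"
  assumes h: "(h has_real_derivative D) (at 0 within {0..1})"
    and min: "\<And>t. t \<in> {0..1} \<Longrightarrow> h 0 \<le> h t"
  shows "0 \<le> D"
proof -
  have "((\<lambda>t. (h t - h 0) / (t - 0)) \<longlongrightarrow> D) (at 0 within {0..1})"
    using h unfolding has_field_derivative_iff by simp
  moreover have "\<forall>\<^sub>F t in at 0 within {0..1}. 0 \<le> (h t - h 0) / (t - 0)"
    unfolding eventually_at_filter using min by (auto intro!: always_eventually divide_nonneg_nonneg)
  moreover have "at (0::real) within {0..1} \<noteq> bot"
    by (simp add: at_within_Icc_at_right)
  ultimately show ?thesis by (metis tendsto_lowerbound)
qed

text \<open>With \<open>c = 0\<close> this is the gradient inequality of a convex function, with \<open>c\<close> a squared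
  distance that of a strongly convex one.\<close>

lemma gradient_inequality:
  fixes f :: "'a::real_inner \<Rightarrow> real"
  assumes D: "convex D" "x \<in> D" "y \<in> D"
    and f: "(f has_derivative (\<lambda>h. g \<bullet> h)) (at x within D)"
    and le: "\<And>t. t \<in> {0..1} \<Longrightarrow>
      f ((1 - t) *\<^sub>R x + t *\<^sub>R y) \<le> (1 - t) * f x + t * f y - (1 / 2) * t * (1 - t) * c"
  shows "g \<bullet> (y - x) + c / 2 \<le> f y - f x"
proof -
  let ?h = "\<lambda>t. (1 - t) * f x + t * f y - (1 / 2) * t * (1 - t) * c - f (x + t *\<^sub>R (y - x))"
  have "0 \<le> f y - f x - c / 2 - g \<bullet> (y - x)"
  proof (rule derivative_nonneg_at_left_min)
    show "(?h has_real_derivative f y - f x - c / 2 - g \<bullet> (y - x)) (at 0 within {0..1})"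
      by (rule derivative_eq_intros segment_derivative[OF D f] refl)+ (simp add: algebra_simps)
    show "?h 0 \<le> ?h t" if "t \<in> {0..1}" for t
      using le[OF that] by (simp add: segment_param)
  qed
  then show ?thesis by simp
qed

lemma gradient_inequality_convex:
  fixes f :: "'a::real_inner \<Rightarrow> real"
  assumes "convex_on D f" "x \<in> D" "y \<in> D" "(f has_derivative (\<lambda>h. g \<bullet> h)) (at x within D)"
  shows "g \<bullet> (y - x) \<le> f y - f x"
  using gradient_inequality[OF _ assms(2-4), of 0] convex_onD[OF assms(1), of _ x y] assms
  by (auto simp: convex_on_def)

lemma gradient_inequality_strongly_convex:
  assumes "strongly_convex_on p D f" "C1_on S D f g" "x \<in> D" "y \<in> D"
  shows "(p (x - y))\<^sup>2 / 2 \<le> f y - f x - g x \<bullet> (y - x)"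
  using gradient_inequality[of D x y f "g x" "(p (x - y))\<^sup>2"] assms
  unfolding strongly_convex_on_def C1_on_def by auto

section \<open>Coercive functions attain their minimum\<close>

lemma coercive_attains_inf:
  fixes g :: "'a::euclidean_space \<Rightarrow> real"
  assumes C: "closed C" "C \<noteq> {}" and g: "continuous_on C g"
    and coercive: "\<And>s :: nat \<Rightarrow> 'a. \<forall>i. s i \<in> C \<Longrightarrow>
      filterlim (\<lambda>i. norm (s i)) at_top sequentially \<Longrightarrow> filterlim (\<lambda>i. g (s i)) at_top sequentially"
  obtains c where "c \<in> C" "\<And>x. x \<in> C \<Longrightarrow> g c \<le> g x"
proof -
  obtain a where a: "a \<in> C" using C by blast
  let ?L = "{x \<in> C. g x \<le> g a}"
  have "bounded ?L"
  proof (rule ccontr)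
    assume "\<not> bounded ?L"
    then have "\<forall>n::nat. \<exists>x\<in>?L. real n < norm x"
      unfolding bounded_iff by (meson not_le)
    then obtain s where s: "\<And>n::nat. s n \<in> ?L" "\<And>n. real n < norm (s n)" by metis
    have "filterlim (\<lambda>n. norm (s n)) at_top sequentially"
      using s(2) by (intro filterlim_at_top_mono[OF filterlim_real_sequentially])
        (auto intro: always_eventually less_imp_le)
    then have "filterlim (\<lambda>n. g (s n)) at_top sequentially" using coercive s(1) by simp
    then have "\<forall>\<^sub>F n in sequentially. g a + 1 \<le> g (s n)" by (simp add: filterlim_at_top)
    then obtain n where "g a + 1 \<le> g (s n)" using eventually_happens by fastforce
    then show False using s(1)[of n] by simp
  qed
  moreover have "closed ?L"
    using continuous_closed_preimage[OF g C(1), of "{..g a}"] by (simp add: vimage_def Int_def)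
  ultimately have cmp: "compact ?L" by (simp add: compact_eq_bounded_closed)
  have ne: "?L \<noteq> {}" using a by blast
  have "continuous_on ?L g" using g by (rule continuous_on_subset) auto
  from continuous_attains_inf[OF cmp ne this]
  obtain c where "c \<in> ?L" "\<forall>x\<in>?L. g c \<le> g x"
    by auto
  then show thesis using that[of c] by force
qed

section \<open>The multi-term setting\<close>

fun x2_part :: "('a, 'b) xpoint \<Rightarrow> (nat \<Rightarrow> 'b \<times> real) \<times> (nat \<Rightarrow> 'a)" where
  "x2_part ((y, z, w), (\<tau>, \<sigma>)) = (\<lambda>k. (z k, \<sigma> k), w)"

lemma x1_part_eq: "x1_part p = (\<lambda>k. (fst (fst p) k, fst (snd p) k))"
  by (cases p rule: x1_part.cases) simp

lemma x2_part_eq: "x2_part p = (\<lambda>k. (fst (snd (fst p)) k, snd (snd p) k), snd (snd (fst p)))"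
  by (cases p rule: x2_part.cases) simp

lemma X1_iff:
  "x1 \<in> X1 P \<longleftrightarrow> (\<forall>k\<le>Knum P. fst (x1 k) \<in> Yset P k \<and> PsiY P k (fst (x1 k)) \<le> snd (x1 k))"
  by (auto simp: X1_def Pi_iff case_prod_unfold)

lemma X2_iff:
  "(zs, w) \<in> X2 P \<longleftrightarrow>
    (\<forall>k\<le>Knum P. fst (zs k) \<in> Zset P k \<and> PsiZ P k (fst (zs k)) \<le> snd (zs k)) \<and>
    (\<forall>k\<in>{1..Knum P}. w k \<in> Wset P k)"
  by (auto simp: X2_def Pi_iff case_prod_unfold)

lemma sum_atMost_eq_head: "(\<Sum>k\<le>n. f k) = f 0 + (\<Sum>k=1..n. f (k::nat))"
  for f :: "nat \<Rightarrow> 'a::comm_monoid_add"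
  by (simp add: atMost_atLeast0 sum.atLeast_Suc_atMost)

locale mt_problem =
  fixes P :: "('a::euclidean_space, 'b::euclidean_space) mt_data"
  assumes setting: "mt_setting P"
begin

lemma
  assumes "k \<le> Knum P"
  shows subspace_E: "subspace (Esp P k)" and subspace_EZ: "subspace (EZsp P k)"
    and Y_nonempty: "Yset P k \<noteq> {}" and closed_Y: "closed (Yset P k)"
    and convex_Y: "convex (Yset P k)" and Y_subset: "Yset P k \<subseteq> Esp P k"
    and convex_Z: "convex (Zset P k)" and Z_subset: "Zset P k \<subseteq> EZsp P k"
    and pnorm: "norm_on (Esp P k) (pnorm P k)" and qnorm: "norm_on (EZsp P k) (qnorm P k)"
    and omY_C1: "C1_on (Esp P k) (Yset P k) (omY P k) (gomY P k)"
    and omY_strongly_convex: "strongly_convex_on (pnorm P k) (Yset P k) (omY P k)"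
    and omZ_C1: "C1_on (EZsp P k) (Zset P k) (omZ P k) (gomZ P k)"
    and omZ_strongly_convex: "strongly_convex_on (qnorm P k) (Zset P k) (omZ P k)"
    and linear_A: "linear (Amap P k)"
    and psi_lipschitz: "\<exists>C. C-lipschitz_on (Yset P k) (psi P k)"
    and PsiY_lipschitz: "\<exists>C. C-lipschitz_on (Yset P k) (PsiY P k)"
    and psi_SUP: "\<forall>y\<in>Yset P k. ereal (psi P k y) = (SUP z\<in>Zset P k. ereal (phi P k y z - PsiZ P k z))"
    and phi_derivative: "\<forall>y\<in>Yset P k. \<forall>z\<in>Zset P k.
          ((\<lambda>(y, z). phi P k y z) has_derivative
             (\<lambda>(h, g). gphiY P k y z \<bullet> h + gphiZ P k y z \<bullet> g))
            (at (y, z) within Yset P k \<times> Zset P k)"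
    and phi_convex: "\<forall>z\<in>Zset P k. convex_on (Yset P k) (\<lambda>y. phi P k y z)"
    and phi_concave: "\<forall>y\<in>Yset P k. concave_on (Zset P k) (\<lambda>z. phi P k y z)"
    and PsiZ_convex: "convex_on (Zset P k) (PsiZ P k)"
    and PsiY_convex: "convex_on (Yset P k) (PsiY P k)"
    and wtY_pos: "0 < wtY P k" and wtZ_pos: "0 < wtZ P k"
  using assms setting unfolding mt_setting_def by simp_all

lemma
  assumes "k \<in> {1..Knum P}"
  shows pistar: "norm_on (Esp P k) (pistar P k)"
    and omW_C1: "C1_on (Esp P k) (Wset P k) (omW P k) (gomW P k)"
    and omW_strongly_convex: "strongly_convex_on (pinorm P k) (Wset P k) (omW P k)"
    and rho_pos: "0 < rho P k" and wtW_pos: "0 < wtW P k"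
  using assms setting unfolding mt_setting_def by blast+

lemma A0_identity: "y \<in> Esp P 0 \<Longrightarrow> Amap P 0 y + bvec P 0 = y"
  using setting unfolding mt_setting_def by blast

lemma pinorm: "k \<in> {1..Knum P} \<Longrightarrow> norm_on (Esp P k) (pinorm P k)"
  unfolding pinorm_def using norm_on_conj_norm subspace_E pistar by auto

lemma convex_W: "k \<in> {1..Knum P} \<Longrightarrow> convex (Wset P k)"
  using omW_strongly_convex unfolding strongly_convex_on_def by blast

lemma W_subset: "Wset P k \<subseteq> Esp P k"
  unfolding Wset_def by blast

lemma Xset_iff:
  "((y, z, w), (\<tau>, \<sigma>)) \<in> Xset P \<longleftrightarrow>
    (\<forall>k\<le>Knum P. y k \<in> Yset P k \<and> z k \<in> Zset P k \<and> PsiY P k (y k) \<le> \<tau> k \<and> PsiZ P k (z k) \<le> \<sigma> k) \<and>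
    (\<forall>k\<in>{1..Knum P}. w k \<in> Wset P k)"
  unfolding Xset_def Uset_def by auto

lemma Xset_Uset: "p \<in> Xset P \<Longrightarrow> fst p \<in> Uset P"
  unfolding Xset_def by auto

lemma Xset_parts:
  assumes "p \<in> Xset P"
  shows "x1_part p \<in> X1 P" and "x2_part p \<in> X2 P"
  using assms Xset_iff[of "fst (fst p)" "fst (snd (fst p))" "snd (snd (fst p))" "fst (snd p)" "snd (snd p)"]
  by (simp_all add: x1_part_eq x2_part_eq X1_iff X2_iff)

lemma regroup_in_Xset:
  assumes "x1 \<in> X1 P" "x2 \<in> X2 P"
  shows "regroup (x1, x2) \<in> Xset P" "x1_part (regroup (x1, x2)) = x1" "x2_part (regroup (x1, x2)) = x2"
  using assms by (cases x2; simp add: X1_iff X2_iff Xset_iff)+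

section \<open>Pairings, norms and Bregman distances of tuples\<close>

lemma uinner_diff_right: "uinner P a (b - c) = uinner P a b - uinner P a c"
  for a b c :: "('a, 'b) upoint"
  by (cases a; cases b; cases c)
    (simp add: inner_diff_right sum_subtractf sum.distrib algebra_simps)

lemma uinner_diff_left: "uinner P (a - b) c = uinner P a c - uinner P b c"
  for a b c :: "('a, 'b) upoint"
  by (cases a; cases b; cases c)
    (simp add: inner_diff_left sum_subtractf sum.distrib algebra_simps)

lemma vinner_diff_right: "vinner P a (b - c) = vinner P a b - vinner P a c"
  by (cases a; cases b; cases c)
    (simp add: right_diff_distrib sum_subtractf sum.distrib algebra_simps)

lemma uinner_xscale: "uinner P (fst (xscale c \<xi>)) h = c * uinner P (fst \<xi>) h"
  for \<xi> :: "('a, 'b) xpoint"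
proof -
  obtain y z w \<tau> \<sigma> where "\<xi> = ((y, z, w), (\<tau>, \<sigma>))" by (metis surj_pair)
  then show ?thesis
    by (cases h rule: prod_cases3) (simp add: sum_distrib_left distrib_left)
qed

lemma vinner_xscale: "vinner P (snd (xscale c \<xi>)) h = c * vinner P (snd \<xi>) h"
  for \<xi> :: "('a, 'b) xpoint"
proof -
  obtain y z w \<tau> \<sigma> where "\<xi> = ((y, z, w), (\<tau>, \<sigma>))" by (metis surj_pair)
  then show ?thesis
    by (cases h) (simp add: sum_distrib_left distrib_left mult.assoc)
qed

lemma unorm_nonneg: "0 \<le> unorm P u"
proof (cases u rule: prod_cases3)
  case (fields y z w)
  have "0 \<le> (\<Sum>k\<le>Knum P. wtY P k * (pnorm P k (y k))\<^sup>2 + wtZ P k * (qnorm P k (z k))\<^sup>2)"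
    by (intro sum_nonneg add_nonneg_nonneg mult_nonneg_nonneg) (auto simp: less_imp_le wtY_pos wtZ_pos)
  moreover have "0 \<le> (\<Sum>k=1..Knum P. wtW P k * (pinorm P k (w k))\<^sup>2)"
    by (intro sum_nonneg mult_nonneg_nonneg) (auto simp: less_imp_le wtW_pos)
  ultimately show ?thesis using fields by simp
qed

lemma unorm_power2:
  "(unorm P (y, z, w))\<^sup>2 =
    (\<Sum>k\<le>Knum P. wtY P k * (pnorm P k (y k))\<^sup>2 + wtZ P k * (qnorm P k (z k))\<^sup>2) +
    (\<Sum>k=1..Knum P. wtW P k * (pinorm P k (w k))\<^sup>2)"
  using unorm_nonneg[of "(y, z, w)"] by simp

lemma Uspace_diff:
  assumes "u \<in> Uset P" "s \<in> Uset P"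
  shows "u - s \<in> Uspace P"
proof -
  have "y k - y' k \<in> Esp P k" if "k \<le> Knum P" "y k \<in> Yset P k" "y' k \<in> Yset P k" for k y y'
    using that Y_subset[OF that(1)] subspace_diff[OF subspace_E[OF that(1)]] by blast
  moreover have "z k - z' k \<in> EZsp P k" if "k \<le> Knum P" "z k \<in> Zset P k" "z' k \<in> Zset P k" for k z z'
    using that Z_subset[OF that(1)] subspace_diff[OF subspace_EZ[OF that(1)]] by blast
  moreover have "w k - w' k \<in> Esp P k" if "k \<in> {1..Knum P}" "w k \<in> Wset P k" "w' k \<in> Wset P k" for k w w'
    using that W_subset[of k] subspace_diff[OF subspace_E[of k]] by auto
  ultimately show ?thesis
    using assms unfolding Uset_def Uspace_def by (auto simp: Pi_iff)
qed

lemma unorm_scale: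
  assumes "(y, z, w) \<in> Uspace P"
  shows "unorm P (\<lambda>k. c *\<^sub>R y k, \<lambda>k. c *\<^sub>R z k, \<lambda>k. c *\<^sub>R w k) = \<bar>c\<bar> * unorm P (y, z, w)"
proof -
  have 1: "pnorm P k (c *\<^sub>R y k) = \<bar>c\<bar> * pnorm P k (y k)" "qnorm P k (c *\<^sub>R z k) = \<bar>c\<bar> * qnorm P k (z k)"
    if "k \<le> Knum P" for k
    using assms that norm_on_scaleR[OF pnorm] norm_on_scaleR[OF qnorm] unfolding Uspace_def by (auto simp: Pi_iff)
  have 2: "pinorm P k (c *\<^sub>R w k) = \<bar>c\<bar> * pinorm P k (w k)" if "k \<in> {1..Knum P}" for k
    using assms that norm_on_scaleR[OF pinorm] unfolding Uspace_def by (auto simp: Pi_iff)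
  have "(unorm P (\<lambda>k. c *\<^sub>R y k, \<lambda>k. c *\<^sub>R z k, \<lambda>k. c *\<^sub>R w k))\<^sup>2 = (\<bar>c\<bar> * unorm P (y, z, w))\<^sup>2"
    unfolding power_mult_distrib unorm_power2
    by (simp add: 1 2 power_mult_distrib sum_distrib_left distrib_left mult.left_commute)
  then show ?thesis
    by (metis abs_ge_zero mult_nonneg_nonneg power2_eq_imp_eq unorm_nonneg)
qed

lemma unorm_minus_commute:
  assumes "u \<in> Uset P" "s \<in> Uset P"
  shows "unorm P (u - s) = unorm P (s - u)"
proof (cases "u - s" rule: prod_cases3)
  case (fields y z w)
  have "s - u = (\<lambda>k. (-1) *\<^sub>R y k, \<lambda>k. (-1) *\<^sub>R z k, \<lambda>k. (-1) *\<^sub>R w k)"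
    using fields by (cases u rule: prod_cases3; cases s rule: prod_cases3) auto
  then show ?thesis
    using unorm_scale[of y z w "-1"] Uspace_diff[OF assms] fields by simp
qed

text \<open>Consequently the supremum that defines the conjugate norm of tuples is over a set of reals bounded
  above, as the duality inequality below requires.\<close>

lemma uinner_bounded: "\<exists>M. \<forall>h\<in>Uspace P. uinner P \<xi> h \<le> M * unorm P h"
proof (cases \<xi> rule: prod_cases3)
  case (fields a b c)
  have "\<exists>M. 0 \<le> M \<and> (\<forall>h\<in>Esp P k. a k \<bullet> h \<le> M * sqrt (wtY P k * (pnorm P k h)\<^sup>2))"
    if "k \<le> Knum P" for k
    using inner_le_weighted_norm[OF subspace_E pnorm wtY_pos, OF that that that, of "a k"] by metis
  then obtain MY where MY: "\<And>k. k \<le> Knum P \<Longrightarrow> 0 \<le> MY k"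
    "\<And>k h. k \<le> Knum P \<Longrightarrow> h \<in> Esp P k \<Longrightarrow> a k \<bullet> h \<le> MY k * sqrt (wtY P k * (pnorm P k h)\<^sup>2)"
    by metis
  have "\<exists>M. 0 \<le> M \<and> (\<forall>h\<in>EZsp P k. b k \<bullet> h \<le> M * sqrt (wtZ P k * (qnorm P k h)\<^sup>2))"
    if "k \<le> Knum P" for k
    using inner_le_weighted_norm[OF subspace_EZ qnorm wtZ_pos, OF that that that, of "b k"] by metis
  then obtain MZ where MZ: "\<And>k. k \<le> Knum P \<Longrightarrow> 0 \<le> MZ k"
    "\<And>k h. k \<le> Knum P \<Longrightarrow> h \<in> EZsp P k \<Longrightarrow> b k \<bullet> h \<le> MZ k * sqrt (wtZ P k * (qnorm P k h)\<^sup>2)"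
    by metis
  have "\<exists>M. 0 \<le> M \<and> (\<forall>h\<in>Esp P k. c k \<bullet> h \<le> M * sqrt (wtW P k * (pinorm P k h)\<^sup>2))"
    if "k \<in> {1..Knum P}" for k
    using inner_le_weighted_norm[OF subspace_E pinorm wtW_pos, OF _ that that, of "c k"] that
    by (metis atLeastAtMost_iff)
  then obtain MW where MW: "\<And>k. k \<in> {1..Knum P} \<Longrightarrow> 0 \<le> MW k"
    "\<And>k h. k \<in> {1..Knum P} \<Longrightarrow> h \<in> Esp P k \<Longrightarrow> c k \<bullet> h \<le> MW k * sqrt (wtW P k * (pinorm P k h)\<^sup>2)"
    by metis
  have "uinner P \<xi> u \<le> ((\<Sum>k\<le>Knum P. MY k + MZ k) + (\<Sum>k=1..Knum P. MW k)) * unorm P u"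
    if u: "u \<in> Uspace P" for u
  proof (cases u rule: prod_cases3)
    case (fields h g r)
    have hgr: "\<And>k. k \<le> Knum P \<Longrightarrow> h k \<in> Esp P k" "\<And>k. k \<le> Knum P \<Longrightarrow> g k \<in> EZsp P k"
      "\<And>k. k \<in> {1..Knum P} \<Longrightarrow> r k \<in> Esp P k"
      using u fields unfolding Uspace_def by auto
    let ?A = "\<lambda>k. wtY P k * (pnorm P k (h k))\<^sup>2" and ?B = "\<lambda>k. wtZ P k * (qnorm P k (g k))\<^sup>2"
    let ?C = "\<lambda>k. wtW P k * (pinorm P k (r k))\<^sup>2"
    have nonneg: "\<And>k. k \<le> Knum P \<Longrightarrow> 0 \<le> ?A k" "\<And>k. k \<le> Knum P \<Longrightarrow> 0 \<le> ?B k"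
      "\<And>k. k \<in> {1..Knum P} \<Longrightarrow> 0 \<le> ?C k"
      using wtY_pos wtZ_pos wtW_pos by (auto simp: less_imp_le)
    have C_nonneg: "0 \<le> (\<Sum>k=1..Knum P. ?C k)"
      using nonneg(3) by (rule sum_nonneg)
    have AB_le: "?A k + ?B k \<le> (\<Sum>k\<le>Knum P. ?A k + ?B k)" if "k \<le> Knum P" for k
      using member_le_sum[of k "{..Knum P}" "\<lambda>k. ?A k + ?B k"] nonneg(1,2) that by simp
    have AB_nonneg: "0 \<le> (\<Sum>k\<le>Knum P. ?A k + ?B k)"
      using nonneg(1,2) by (intro sum_nonneg add_nonneg_nonneg) auto
    have sq: "unorm P u = sqrt ((\<Sum>k\<le>Knum P. ?A k + ?B k) + (\<Sum>k=1..Knum P. ?C k))"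
      using fields by simp
    have A: "sqrt (?A k) \<le> unorm P u" if "k \<le> Knum P" for k
      unfolding sq using AB_le[OF that] nonneg(2)[OF that] C_nonneg by simp
    have B: "sqrt (?B k) \<le> unorm P u" if "k \<le> Knum P" for k
      unfolding sq using AB_le[OF that] nonneg(1)[OF that] C_nonneg by simp
    have C: "sqrt (?C k) \<le> unorm P u" if "k \<in> {1..Knum P}" for k
      unfolding sq using member_le_sum[of k "{1..Knum P}" ?C] nonneg(3) that AB_nonneg by simp
    have "uinner P \<xi> u = (\<Sum>k\<le>Knum P. a k \<bullet> h k + b k \<bullet> g k) + (\<Sum>k=1..Knum P. c k \<bullet> r k)"
      using fields \<open>\<xi> = (a, b, c)\<close> by simp
    also have "\<dots> \<le> (\<Sum>k\<le>Knum P. MY k * unorm P u + MZ k * unorm P u) + (\<Sum>k=1..Knum P. MW k * unorm P u)"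
    proof (intro add_mono sum_mono)
      fix k assume k: "k \<in> {..Knum P}"
      show "a k \<bullet> h k \<le> MY k * unorm P u"
        using MY(2)[of k "h k"] mult_left_mono[OF A MY(1), of k k] hgr(1) k by fastforce
      show "b k \<bullet> g k \<le> MZ k * unorm P u"
        using MZ(2)[of k "g k"] mult_left_mono[OF B MZ(1), of k k] hgr(2) k by fastforce
    next
      fix k assume k: "k \<in> {1..Knum P}"
      show "c k \<bullet> r k \<le> MW k * unorm P u"
        using MW(2)[OF k hgr(3)[OF k]] mult_left_mono[OF C[OF k] MW(1)[OF k]] by simp
    qed
    finally show ?thesis
      by (simp add: sum_distrib_right distrib_right sum.distrib)
  qed
  then show ?thesis by blast
qed

lemma uinner_le_unorm_dual:
  assumes h: "h \<in> Uspace P"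
  shows "uinner P \<xi> h \<le> unorm_dual P \<xi> * unorm P h"
proof (cases "unorm P h = 0")
  case True
  then show ?thesis using uinner_bounded[of \<xi>] h by force
next
  case False
  then have pos: "0 < unorm P h" using unorm_nonneg[of h] by simp
  obtain M where M: "\<And>h. h \<in> Uspace P \<Longrightarrow> uinner P \<xi> h \<le> M * unorm P h"
    using uinner_bounded[of \<xi>] by blast
  have "bdd_above (uinner P \<xi> ` {h \<in> Uspace P. unorm P h \<le> 1})"
  proof (rule bdd_aboveI2)
    fix g assume g: "g \<in> {h \<in> Uspace P. unorm P h \<le> 1}"
    have "uinner P \<xi> g \<le> M * unorm P g" using M g by blast
    also have "\<dots> \<le> \<bar>M\<bar> * unorm P g" using unorm_nonneg by (intro mult_right_mono) auto
    also have "\<dots> \<le> \<bar>M\<bar> * 1" using g by (intro mult_left_mono) auto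
    finally show "uinner P \<xi> g \<le> \<bar>M\<bar>" by simp
  qed
  note upper = cSUP_upper[OF _ this]
  obtain y z w where hf: "h = (y, z, w)" by (cases h rule: prod_cases3)
  let ?c = "inverse (unorm P h)"
  let ?g = "(\<lambda>k. ?c *\<^sub>R y k, \<lambda>k. ?c *\<^sub>R z k, \<lambda>k. ?c *\<^sub>R w k)"
  have "?g \<in> Uspace P"
    using h hf subspace_E subspace_EZ unfolding Uspace_def by (auto simp: Pi_iff subspace_scale simp del: unorm.simps)
  moreover have "unorm P ?g = 1"
    using unorm_scale[of y z w ?c] h hf pos by simp
  ultimately have "uinner P \<xi> ?g \<le> unorm_dual P \<xi>"
    unfolding unorm_dual_def by (intro upper) auto
  moreover have "uinner P \<xi> ?g = ?c * uinner P \<xi> h"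
    using hf by (cases \<xi> rule: prod_cases3) (simp add: sum_distrib_left distrib_left)
  ultimately have "?c * uinner P \<xi> h \<le> unorm_dual P \<xi>" by simp
  then show ?thesis using pos by (simp add: field_simps)
qed

lemma Vdist_ge_unorm:
  assumes "u \<in> Uset P" "s \<in> Uset P"
  shows "(unorm P (u - s))\<^sup>2 / 2 \<le> Vdist P u s"
proof -
  obtain y z w where u: "u = (y, z, w)" by (cases u rule: prod_cases3)
  obtain y' z' w' where s: "s = (y', z', w')" by (cases s rule: prod_cases3)
  have "u - s = (\<lambda>k. y k - y' k, \<lambda>k. z k - z' k, \<lambda>k. w k - w' k)"
    unfolding u s by (auto simp: fun_eq_iff)
  then have "(unorm P (u - s))\<^sup>2 / 2 =
    (\<Sum>k\<le>Knum P. wtY P k * ((pnorm P k (y k - y' k))\<^sup>2 / 2) + wtZ P k * ((qnorm P k (z k - z' k))\<^sup>2 / 2)) +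
    (\<Sum>k=1..Knum P. wtW P k * ((pinorm P k (w k - w' k))\<^sup>2 / 2))"
    by (simp only: unorm_power2) (simp add: sum_divide_distrib add_divide_distrib)
  also have "\<dots> \<le>
    (\<Sum>k\<le>Knum P. wtY P k * (omY P k (y' k) - omY P k (y k) - gomY P k (y k) \<bullet> (y' k - y k)) +
      wtZ P k * (omZ P k (z' k) - omZ P k (z k) - gomZ P k (z k) \<bullet> (z' k - z k))) +
    (\<Sum>k=1..Knum P. wtW P k * (omW P k (w' k) - omW P k (w k) - gomW P k (w k) \<bullet> (w' k - w k)))"
  proof (intro add_mono sum_mono)
    fix k assume "k \<in> {..Knum P}"
    then have k: "k \<le> Knum P" by simp
    show "wtY P k * ((pnorm P k (y k - y' k))\<^sup>2 / 2)
        \<le> wtY P k * (omY P k (y' k) - omY P k (y k) - gomY P k (y k) \<bullet> (y' k - y k))"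
      using gradient_inequality_strongly_convex[OF omY_strongly_convex[OF k] omY_C1[OF k], of "y k" "y' k"]
        wtY_pos[OF k] assms k u s unfolding Uset_def by (intro mult_left_mono) (auto simp: Pi_iff)
    show "wtZ P k * ((qnorm P k (z k - z' k))\<^sup>2 / 2)
        \<le> wtZ P k * (omZ P k (z' k) - omZ P k (z k) - gomZ P k (z k) \<bullet> (z' k - z k))"
      using gradient_inequality_strongly_convex[OF omZ_strongly_convex[OF k] omZ_C1[OF k], of "z k" "z' k"]
        wtZ_pos[OF k] assms k u s unfolding Uset_def by (intro mult_left_mono) (auto simp: Pi_iff)
  next
    fix k assume k: "k \<in> {1..Knum P}"
    show "wtW P k * ((pinorm P k (w k - w' k))\<^sup>2 / 2)
        \<le> wtW P k * (omW P k (w' k) - omW P k (w k) - gomW P k (w k) \<bullet> (w' k - w k))"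
      using gradient_inequality_strongly_convex[OF omW_strongly_convex[OF k] omW_C1[OF k], of "w k" "w' k"]
        wtW_pos[OF k] assms k u s unfolding Uset_def by (intro mult_left_mono) (auto simp: Pi_iff)
  qed
  also have "\<dots> = Vdist P u s"
    unfolding Vdist_def u s
    by (simp add: sum.distrib sum_subtractf algebra_simps)
  finally show ?thesis .
qed

lemma Vdist_nonneg:
  assumes "u \<in> Uset P" "s \<in> Uset P"
  shows "0 \<le> Vdist P u s"
  by (rule order_trans[OF _ Vdist_ge_unorm[OF assms]]) simp

section \<open>The Mirror Prox recursion\<close>

fun useg :: "('a, 'b) upoint \<Rightarrow> ('a, 'b) upoint \<Rightarrow> real \<Rightarrow> ('a, 'b) upoint" where
  "useg (y, z, w) (y', z', w') t =
    (\<lambda>k. y k + t *\<^sub>R (y' k - y k), \<lambda>k. z k + t *\<^sub>R (z' k - z k), \<lambda>k. w k + t *\<^sub>R (w' k - w k))"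

fun vseg :: "vpoint \<Rightarrow> vpoint \<Rightarrow> real \<Rightarrow> vpoint" where
  "vseg (\<tau>, \<sigma>) (\<tau>', \<sigma>') t = (\<lambda>k. \<tau> k + t * (\<tau>' k - \<tau> k), \<lambda>k. \<sigma> k + t * (\<sigma>' k - \<sigma> k))"

lemma uinner_useg: "uinner P a (useg u s t) = uinner P a u + t * uinner P a (s - u)"
  by (cases a rule: prod_cases3; cases u rule: prod_cases3; cases s rule: prod_cases3)
    (simp add: inner_add_right inner_diff_right sum.distrib sum_subtractf sum_distrib_left algebra_simps)

lemma vinner_vseg: "vinner P a (vseg u s t) = vinner P a u + t * vinner P a (s - u)"
  by (cases a; cases u; cases s)
    (simp add: sum.distrib sum_subtractf sum_distrib_left algebra_simps)

lemma useg_vseg_in_Xset: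
  assumes "p \<in> Xset P" "s \<in> Xset P" and t: "t \<in> {0..1}"
  shows "(useg (fst p) (fst s) t, vseg (snd p) (snd s) t) \<in> Xset P"
proof -
  obtain y z w \<tau> \<sigma> where p: "p = ((y, z, w), (\<tau>, \<sigma>))" by (metis surj_pair)
  obtain y' z' w' \<tau>' \<sigma>' where s: "s = ((y', z', w'), (\<tau>', \<sigma>'))" by (metis surj_pair)
  have epi: "f (x + t *\<^sub>R (x' - x)) \<le> r + t * (r' - r)"
    if "convex_on D f" "x \<in> D" "x' \<in> D" "f x \<le> r" "f x' \<le> r'"
    for D and f :: "'c::real_vector \<Rightarrow> real" and x x' r r'
  proof -
    have "f (x + t *\<^sub>R (x' - x)) \<le> (1 - t) * f x + t * f x'"
      unfolding segment_param using that t by (intro convex_onD[OF that(1)]) auto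
    also have "\<dots> \<le> (1 - t) * r + t * r'"
      using that t by (intro add_mono mult_left_mono) auto
    finally show ?thesis by (simp add: algebra_simps)
  qed
  show ?thesis
    using assms(1,2) unfolding p s
    by (auto simp: Xset_iff intro!: segment_in_convex[OF _ _ _ t] convex_Y convex_Z convex_W
        epi[OF PsiY_convex] epi[OF PsiZ_convex])
qed

lemma omega_derivative:
  assumes "u \<in> Uset P" "s \<in> Uset P"
  shows "((\<lambda>t. omega P (useg u s t)) has_real_derivative uinner P (gomega P u) (s - u))
    (at 0 within {0..1})"
proof -
  obtain y z w where u: "u = (y, z, w)" by (cases u rule: prod_cases3)
  obtain y' z' w' where s: "s = (y', z', w')" by (cases s rule: prod_cases3)
  have Y: "((\<lambda>t. omY P k (y k + t *\<^sub>R (y' k - y k))) has_real_derivative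
      gomY P k (y k) \<bullet> (y' k - y k)) (at 0 within {0..1})" if "k \<in> {..Knum P}" for k
    using assms that omY_C1[of k] unfolding u s Uset_def C1_on_def
    by (intro segment_derivative[OF convex_Y[of k]]) auto
  have Z: "((\<lambda>t. omZ P k (z k + t *\<^sub>R (z' k - z k))) has_real_derivative
      gomZ P k (z k) \<bullet> (z' k - z k)) (at 0 within {0..1})" if "k \<in> {..Knum P}" for k
    using assms that omZ_C1[of k] unfolding u s Uset_def C1_on_def
    by (intro segment_derivative[OF convex_Z[of k]]) auto
  have W: "((\<lambda>t. omW P k (w k + t *\<^sub>R (w' k - w k))) has_real_derivative
      gomW P k (w k) \<bullet> (w' k - w k)) (at 0 within {0..1})" if "k \<in> {1..Knum P}" for k
    using assms that omW_C1[of k] unfolding u s Uset_def C1_on_def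
    by (intro segment_derivative[OF convex_W[of k]]) auto
  show ?thesis
    unfolding u s
    by (auto intro!: DERIV_add DERIV_sum DERIV_cmult Y Z W)
qed

text \<open>First-order optimality of the prox point along segments of the feasible set, rewritten by the
  identity \<open>V\<^sub>u(s) - V\<^sub>p(s) - V\<^sub>u(p) = \<langle>\<omega>'(p) - \<omega>'(u), s - p\<rangle>\<close>.\<close>

lemma prox_three_point:
  assumes prox: "is_prox P x \<xi> p" and s: "s \<in> Xset P"
  shows "uinner P (fst \<xi>) (fst p - fst s) + vinner P (snd \<xi>) (snd p - snd s)
    \<le> Vdist P (fst x) (fst s) - Vdist P (fst p) (fst s) - Vdist P (fst x) (fst p)"
proof -
  have p: "p \<in> Xset P" using prox unfolding is_prox_def is_arg_min_def by blast
  let ?J = "\<lambda>s. uinner P (fst \<xi>) (fst s) + vinner P (snd \<xi>) (snd s) + Vdist P (fst x) (fst s)"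
  let ?q = "\<lambda>t. (useg (fst p) (fst s) t, vseg (snd p) (snd s) t)"
  let ?g = "gomega P (fst x)"
  let ?D = "uinner P (fst \<xi>) (fst s - fst p) + vinner P (snd \<xi>) (snd s - snd p)
    + uinner P (gomega P (fst p)) (fst s - fst p) - uinner P ?g (fst s - fst p)"
  have "0 \<le> ?D"
  proof (rule derivative_nonneg_at_left_min)
    have eq: "?J (?q t) = uinner P (fst \<xi>) (fst p) + vinner P (snd \<xi>) (snd p) - omega P (fst x)
        - uinner P ?g (fst p) + uinner P ?g (fst x)
        + t * (uinner P (fst \<xi>) (fst s - fst p) + vinner P (snd \<xi>) (snd s - snd p) - uinner P ?g (fst s - fst p))
        + omega P (useg (fst p) (fst s) t)" for t
      by (simp add: Vdist_def uinner_useg vinner_vseg uinner_diff_right[of _ "useg _ _ _"] algebra_simps)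
    show "((\<lambda>t. ?J (?q t)) has_real_derivative ?D) (at 0 within {0..1})"
      unfolding eq
      by (rule derivative_eq_intros omega_derivative Xset_Uset p s refl)+ simp
    show "?J (?q 0) \<le> ?J (?q t)" if t: "t \<in> {0..1}" for t
    proof -
      have "fst (?q 0) = fst p" "snd (?q 0) = snd p"
        by (cases "fst p" rule: prod_cases3; cases "fst s" rule: prod_cases3; simp)
          (cases "snd p"; cases "snd s"; simp)
      then show ?thesis
        using prox useg_vseg_in_Xset[OF p s t] unfolding is_prox_def is_arg_min_def
        by (metis fst_conv snd_conv not_le)
    qed
  qed
  then show ?thesis
    by (simp add: Vdist_def uinner_diff_right vinner_diff_right)
qed

lemma mirror_prox_in_Xset:
  assumes "mirror_prox P \<gamma> x y" and "1 \<le> i"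
  shows "x i \<in> Xset P" and "y i \<in> Xset P"
proof -
  show "y i \<in> Xset P"
    using assms unfolding mirror_prox_def is_prox_def is_arg_min_def by blast
  show "x i \<in> Xset P"
    using assms(2,1)
    by (induction i rule: dec_induct) (auto simp: mirror_prox_def is_prox_def is_arg_min_def)
qed

text \<open>This is \<open>\<langle>F(p), p - s\<rangle>\<close>, the quantity that Mirror Prox drives down and that dominates the saddle
  point gap.\<close>

abbreviation oper_gap :: "('a, 'b) xpoint \<Rightarrow> ('a, 'b) xpoint \<Rightarrow> real" where
  "oper_gap p s \<equiv> uinner P (Fu P (fst p)) (fst p - fst s) + vinner P (\<lambda>k. 1, \<lambda>k. 1) (snd p - snd s)"

text \<open>The prox inequality of the extrapolation point, taken at the next iterate, is added to that of
  the next iterate, taken at \<open>s\<close>. The components \<open>v\<close> of the extrapolation point and the next iterate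
  cancel because that part of the operator is constant, which is why no stepsize condition involves
  the nonsmooth terms \<open>\<Psi>\<^sub>k\<close>.\<close>

lemma mirror_prox_step:
  assumes mp: "mirror_prox P \<gamma> x y" and i: "1 \<le> i" and s: "s \<in> Xset P"
  shows "\<gamma> i * oper_gap (y i) s
    \<le> Vdist P (fst (x i)) (fst s) - Vdist P (fst (x (Suc i))) (fst s) + delta P \<gamma> x y i"
proof -
  have "is_prox P (x i) (xscale (\<gamma> i) (Fop P (x i))) (y i)"
    and "is_prox P (x i) (xscale (\<gamma> i) (Fop P (y i))) (x (Suc i))"
    using mp i unfolding mirror_prox_def by blast+
  from prox_three_point[OF this(1) mirror_prox_in_Xset(1)[OF mp, of "Suc i"]] prox_three_point[OF this(2) s]
  show ?thesis
    by (simp add: delta_def Fop_def uinner_xscale vinner_xscale uinner_diff_right uinner_diff_left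
        vinner_diff_right algebra_simps)
qed

lemma mirror_prox_regret:
  assumes mp: "mirror_prox P \<gamma> x y" and \<delta>: "\<forall>i\<ge>1. delta P \<gamma> x y i \<le> 0" and s: "s \<in> Xset P"
  shows "(\<Sum>i=1..t. \<gamma> i * oper_gap (y i) s) \<le> Vdist P (fst (x 1)) (fst s)"
proof -
  have "(\<Sum>i=1..t. \<gamma> i * oper_gap (y i) s)
      \<le> Vdist P (fst (x 1)) (fst s) - Vdist P (fst (x (Suc t))) (fst s)"
  proof (induction t)
    case (Suc t)
    then show ?case
      using mirror_prox_step[OF mp _ s, of "Suc t"] \<delta>[rule_format, of "Suc t"] by simp
  qed simp
  moreover have "0 \<le> Vdist P (fst (x (Suc t))) (fst s)"
    using mirror_prox_in_Xset(1)[OF mp, of "Suc t"] s by (intro Vdist_nonneg Xset_Uset) auto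
  ultimately show ?thesis by linarith
qed

text \<open>With stepsize \<open>1 / L\<close> the Lipschitz bound turns the positive term of \<open>\<delta>\<close> into a product \<open>a b\<close> of two
  distances, and strong convexity bounds the Bregman distances below by \<open>b\<^sup>2 / 2\<close> and \<open>a\<^sup>2 / 2\<close>.\<close>

lemma delta_nonpos:
  assumes mp: "mirror_prox P \<gamma> x y" and L: "0 < L" "Fu_lipschitz P L" and i: "1 \<le> i" "\<gamma> i = 1 / L"
  shows "delta P \<gamma> x y i \<le> 0"
proof -
  have U: "fst (x i) \<in> Uset P" "fst (y i) \<in> Uset P" "fst (x (Suc i)) \<in> Uset P"
    using mirror_prox_in_Xset[OF mp] i by (auto intro: Xset_Uset)
  let ?a = "unorm P (fst (y i) - fst (x i))" and ?b = "unorm P (fst (y i) - fst (x (Suc i)))"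
  let ?I = "uinner P (Fu P (fst (y i)) - Fu P (fst (x i))) (fst (y i) - fst (x (Suc i)))"
  have "?I \<le> unorm_dual P (Fu P (fst (y i)) - Fu P (fst (x i))) * ?b"
    using U by (intro uinner_le_unorm_dual Uspace_diff)
  also have "\<dots> \<le> (L * ?a) * ?b"
    using L(2) U unorm_nonneg unfolding Fu_lipschitz_def by (intro mult_right_mono) auto
  finally have "\<gamma> i * ?I \<le> \<gamma> i * (L * ?a * ?b)"
    using L(1) i(2) by (intro mult_left_mono) auto
  then have "\<gamma> i * ?I \<le> ?a * ?b"
    using L(1) i(2) by simp
  moreover have "?b\<^sup>2 / 2 \<le> Vdist P (fst (y i)) (fst (x (Suc i)))"
    using U by (intro Vdist_ge_unorm)
  moreover have "?a\<^sup>2 / 2 \<le> Vdist P (fst (x i)) (fst (y i))"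
    using Vdist_ge_unorm[OF U(1,2)] unorm_minus_commute[OF U(1,2)] by simp
  moreover have "2 * ?a * ?b \<le> ?a\<^sup>2 + ?b\<^sup>2"
    by (rule sum_squares_bound)
  ultimately show ?thesis
    unfolding delta_def by linarith
qed

section \<open>From the operator to the saddle point function\<close>

lemma phi_gradient_inequalities:
  assumes k: "k \<le> Knum P" and y: "y \<in> Yset P k" "y' \<in> Yset P k" and z: "z \<in> Zset P k" "z' \<in> Zset P k"
  shows "gphiY P k y z \<bullet> (y' - y) \<le> phi P k y' z - phi P k y z"
    and "phi P k y z' - phi P k y z \<le> gphiZ P k y z \<bullet> (z' - z)"
proof -
  have d: "((\<lambda>(y, z). phi P k y z) has_derivative
      (\<lambda>(h, g). gphiY P k y z \<bullet> h + gphiZ P k y z \<bullet> g)) (at (y, z) within Yset P k \<times> Zset P k)"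
    using phi_derivative[OF k] y z by blast
  have incl: "((\<lambda>v. (v, z)) has_derivative (\<lambda>h. (h, 0))) (at y within Yset P k)"
    by (auto intro!: derivative_eq_intros)
  have "((\<lambda>(y, z). phi P k y z) has_derivative
      (\<lambda>(h, g). gphiY P k y z \<bullet> h + gphiZ P k y z \<bullet> g)) (at (y, z) within (\<lambda>v. (v, z)) ` Yset P k)"
    by (rule has_derivative_subset[OF d]) (use z in auto)
  from has_derivative_in_compose[OF incl this]
  have "((\<lambda>v. phi P k v z) has_derivative (\<lambda>h. gphiY P k y z \<bullet> h)) (at y within Yset P k)"
    by simp
  then show "gphiY P k y z \<bullet> (y' - y) \<le> phi P k y' z - phi P k y z"
    using phi_convex[OF k] y z by (intro gradient_inequality_convex[of "Yset P k" "\<lambda>y. phi P k y z"]) auto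
  have incl: "((\<lambda>v. (y, v)) has_derivative (\<lambda>g. (0, g))) (at z within Zset P k)"
    by (auto intro!: derivative_eq_intros)
  have "((\<lambda>(y, z). phi P k y z) has_derivative
      (\<lambda>(h, g). gphiY P k y z \<bullet> h + gphiZ P k y z \<bullet> g)) (at (y, z) within (\<lambda>v. (y, v)) ` Zset P k)"
    by (rule has_derivative_subset[OF d]) (use y in auto)
  from has_derivative_in_compose[OF incl this]
  have "((\<lambda>v. phi P k y v) has_derivative (\<lambda>g. gphiZ P k y z \<bullet> g)) (at z within Zset P k)"
    by simp
  from has_derivative_minus[OF this]
  have "((\<lambda>v. - phi P k y v) has_derivative (\<lambda>g. (- gphiZ P k y z) \<bullet> g)) (at z within Zset P k)"
    by simp
  then have "(- gphiZ P k y z) \<bullet> (z' - z) \<le> - phi P k y z' - - phi P k y z"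
    using phi_concave[OF k] y z unfolding concave_on_def
    by (intro gradient_inequality_convex[of "Zset P k" "\<lambda>z. - phi P k y z"]) auto
  then show "phi P k y z' - phi P k y z \<le> gphiZ P k y z \<bullet> (z' - z)" by simp
qed

lemma uinner_Fu:
  "uinner P (Fu P (y, z, w)) (h, g, r) =
    (\<Sum>k\<le>Knum P. gphiY P k (y k) (z k) \<bullet> h k - gphiZ P k (y k) (z k) \<bullet> g k) +
    (\<Sum>k=1..Knum P. rho P k * (w k \<bullet> (h k - Amap P k (h 0))) -
      rho P k * ((y k - Amap P k (y 0) - bvec P k) \<bullet> r k))"
proof -
  have adj: "adjoint (Amap P k) v \<bullet> e = v \<bullet> Amap P k e" if "k \<in> {1..Knum P}" for k v e
    using adjoint_works[OF linear_A, of k e v] that by (simp add: inner_commute)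
  have "(\<Sum>k=1..Knum P. rho P k * (w k \<bullet> (h k - Amap P k (h 0))))
      = (\<Sum>k=1..Knum P. rho P k * (w k \<bullet> h k)) - (\<Sum>k=1..Knum P. rho P k * (adjoint (Amap P k) (w k) \<bullet> h 0))"
    unfolding sum_subtractf[symmetric] by (intro sum.cong) (auto simp: adj inner_diff_right algebra_simps)
  then show ?thesis
    by (simp add: sum_atMost_eq_head[of _ "Knum P"] sum.distrib sum_subtractf inner_diff_left inner_add_left
        inner_sum_left sum_negf)
qed

text \<open>The gradient inequalities of \<open>\<phi>\<^sub>k\<close> in \<open>y\<close> and in \<open>z\<close> are added; the bilinear coupling contributes an
  equality, since its diagonal part \<open>\<langle>w, d\<rangle>\<close> cancels.\<close>

lemma Phi_gap_le_oper_gap: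
  assumes p: "p \<in> Xset P" and s: "s \<in> Xset P"
  shows "Phi P (x1_part p) (x2_part s) - Phi P (x1_part s) (x2_part p) \<le> oper_gap p s"
proof -
  obtain y z w \<tau> \<sigma> where pf: "p = ((y, z, w), (\<tau>, \<sigma>))" by (metis surj_pair)
  obtain y' z' w' \<tau>' \<sigma>' where sf: "s = ((y', z', w'), (\<tau>', \<sigma>'))" by (metis surj_pair)
  let ?d = "\<lambda>k. y k - Amap P k (y 0) - bvec P k" and ?d' = "\<lambda>k. y' k - Amap P k (y' 0) - bvec P k"
  have diff: "fst p - fst s = (\<lambda>k. y k - y' k, \<lambda>k. z k - z' k, \<lambda>k. w k - w' k)"
    "snd p - snd s = (\<lambda>k. \<tau> k - \<tau>' k, \<lambda>k. \<sigma> k - \<sigma>' k)"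
    unfolding pf sf by (auto simp: fun_eq_iff)
  have phi: "phi P k (y k) (z' k) - phi P k (y' k) (z k)
      \<le> gphiY P k (y k) (z k) \<bullet> (y k - y' k) - gphiZ P k (y k) (z k) \<bullet> (z k - z' k)"
    if "k \<le> Knum P" for k
    using phi_gradient_inequalities[OF that, of "y k" "y' k" "z k" "z' k"] p s that
    unfolding pf sf by (simp add: Xset_iff inner_diff_right)
  have coupling: "rho P k * (w' k \<bullet> ?d k) - rho P k * (w k \<bullet> ?d' k)
      = rho P k * (w k \<bullet> (y k - y' k - Amap P k (y 0 - y' 0))) - rho P k * (?d k \<bullet> (w k - w' k))"
    if "k \<in> {1..Knum P}" for k
  proof -
    have A: "Amap P k (y 0 - y' 0) = Amap P k (y 0) - Amap P k (y' 0)"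
      using linear_diff[OF linear_A] that by simp
    show ?thesis
      unfolding A by (simp add: inner_diff_left inner_diff_right inner_commute algebra_simps)
  qed
  have "Phi P (x1_part p) (x2_part s) - Phi P (x1_part s) (x2_part p) =
      (\<Sum>k\<le>Knum P. phi P k (y k) (z' k) - phi P k (y' k) (z k) + ((\<tau> k - \<tau>' k) + (\<sigma> k - \<sigma>' k))) +
      (\<Sum>k=1..Knum P. rho P k * (w' k \<bullet> ?d k) - rho P k * (w k \<bullet> ?d' k))"
    unfolding Phi_def pf sf by (simp add: sum.distrib sum_subtractf)
  also have "\<dots> \<le>
      (\<Sum>k\<le>Knum P. gphiY P k (y k) (z k) \<bullet> (y k - y' k) - gphiZ P k (y k) (z k) \<bullet> (z k - z' k)
        + ((\<tau> k - \<tau>' k) + (\<sigma> k - \<sigma>' k))) +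
      (\<Sum>k=1..Knum P. rho P k * (w k \<bullet> (y k - y' k - Amap P k (y 0 - y' 0))) - rho P k * (?d k \<bullet> (w k - w' k)))"
    by (intro add_mono sum_mono order_refl eq_refl[OF coupling]) (use phi in auto)
  also have "\<dots> = oper_gap p s"
    unfolding diff unfolding pf fst_conv uinner_Fu by (simp add: sum.distrib)
  finally show ?thesis .
qed

section \<open>Weighted averages\<close>

context
  fixes \<gamma> :: "nat \<Rightarrow> real" and y :: "nat \<Rightarrow> ('a, 'b) xpoint" and t :: nat
  assumes y: "\<And>i. i \<in> {1..t} \<Longrightarrow> y i \<in> Xset P"
    and \<gamma>: "\<And>i. i \<in> {1..t} \<Longrightarrow> 0 \<le> \<gamma> i" and total: "0 < (\<Sum>i=1..t. \<gamma> i)"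
begin

abbreviation (input) weight :: "nat \<Rightarrow> real" where
  "weight i \<equiv> \<gamma> i / (\<Sum>i=1..t. \<gamma> i)"

lemma weight_nonneg: "i \<in> {1..t} \<Longrightarrow> 0 \<le> weight i"
  using \<gamma> total by simp

lemma sum_weight: "(\<Sum>i=1..t. weight i) = 1"
  using total by (simp add: sum_divide_distrib[symmetric])

lemma weighted_const: "(\<Sum>i=1..t. weight i * c) = c"
  by (simp only: sum_distrib_right[symmetric] sum_weight mult_1)

lemma wmean_eq: "wmean \<gamma> s t k = (\<Sum>i=1..t. weight i *\<^sub>R s i k)"
  unfolding wmean_def by (simp add: scaleR_sum_right divide_inverse mult.commute)

lemma wmean_in_convex:
  assumes "convex C" "\<And>i. i \<in> {1..t} \<Longrightarrow> s i k \<in> C"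
  shows "wmean \<gamma> s t k \<in> C"
  unfolding wmean_eq using assms weight_nonneg sum_weight by (intro convex_sum) auto

lemma convex_on_wmean:
  assumes "convex_on C f" "\<And>i. i \<in> {1..t} \<Longrightarrow> s i k \<in> C"
  shows "f (wmean \<gamma> s t k) \<le> (\<Sum>i=1..t. weight i * f (s i k))"
  unfolding wmean_eq
proof (rule convex_on_sum[OF _ _ assms(1) sum_weight])
  show "{1..t} \<noteq> {}" using total by force
qed (use assms(2) weight_nonneg in auto)

lemma wmean_le:
  assumes "convex_on C f" "\<And>i. i \<in> {1..t} \<Longrightarrow> s i k \<in> C" "\<And>i. i \<in> {1..t} \<Longrightarrow> f (s i k) \<le> r i k"
  shows "f (wmean \<gamma> s t k) \<le> wmean \<gamma> r t k"
proof -
  have "f (wmean \<gamma> s t k) \<le> (\<Sum>i=1..t. weight i * f (s i k))"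
    using assms(1,2) by (rule convex_on_wmean[of C f s k])
  also have "\<dots> \<le> (\<Sum>i=1..t. weight i * r i k)"
    by (intro sum_mono mult_left_mono assms(3) weight_nonneg)
  finally show ?thesis unfolding wmean_eq[of r] by simp
qed

lemma iterate_components:
  assumes "i \<in> {1..t}"
  shows "k \<le> Knum P \<Longrightarrow> fst (fst (y i)) k \<in> Yset P k"
    and "k \<le> Knum P \<Longrightarrow> fst (snd (fst (y i))) k \<in> Zset P k"
    and "k \<le> Knum P \<Longrightarrow> PsiY P k (fst (fst (y i)) k) \<le> fst (snd (y i)) k"
    and "k \<le> Knum P \<Longrightarrow> PsiZ P k (fst (snd (fst (y i))) k) \<le> snd (snd (y i)) k"
    and "k \<in> {1..Knum P} \<Longrightarrow> snd (snd (fst (y i))) k \<in> Wset P k"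
  using Xset_parts[OF y[OF assms]] by (simp_all add: x1_part_eq x2_part_eq X1_iff X2_iff)

lemma approx_sol_in_Xset: "approx_sol \<gamma> y t \<in> Xset P"
  unfolding approx_sol_def Xset_iff
    by (intro conjI allI ballI impI wmean_in_convex convex_Y convex_Z convex_W
        wmean_le[OF PsiY_convex] wmean_le[OF PsiZ_convex])
      (use iterate_components in \<open>blast+\<close>)

text \<open>Apart from the terms \<open>\<phi>\<^sub>k\<close>, the saddle point function is affine in each group of variables, so
  Jensen's inequality is needed for the \<open>\<phi>\<^sub>k\<close> alone.\<close>

lemma Phi_approx_sol_left:
  assumes x2: "x2 \<in> X2 P"
  shows "Phi P (x1_part (approx_sol \<gamma> y t)) x2 \<le> (\<Sum>i=1..t. weight i * Phi P (x1_part (y i)) x2)"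
proof -
  obtain zs w where x2f: "x2 = (zs, w)" by (cases x2)
  let ?Y = "\<lambda>i. fst (fst (y i))" and ?T = "\<lambda>i. fst (snd (y i))"
  have phi: "phi P k (wmean \<gamma> ?Y t k) (fst (zs k)) + wmean \<gamma> ?T t k - snd (zs k)
      \<le> (\<Sum>i=1..t. weight i * (phi P k (?Y i k) (fst (zs k)) + ?T i k - snd (zs k)))"
    if k: "k \<le> Knum P" for k
  proof -
    have "fst (zs k) \<in> Zset P k"
      using x2 k unfolding x2f by (simp add: X2_iff)
    then have "phi P k (wmean \<gamma> ?Y t k) (fst (zs k)) \<le> (\<Sum>i=1..t. weight i * phi P k (?Y i k) (fst (zs k)))"
      using iterate_components(1)[OF _ k] phi_convex[OF k] by (intro convex_on_wmean[of "Yset P k" "\<lambda>v. phi P k v (fst (zs k))"]) auto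
    moreover have "snd (zs k) = (\<Sum>i=1..t. weight i * snd (zs k))"
      by (rule weighted_const[symmetric])
    ultimately show ?thesis
      unfolding wmean_eq[of ?T] by (simp add: distrib_left right_diff_distrib sum.distrib sum_subtractf)
  qed
  have coupling: "w k \<bullet> (wmean \<gamma> ?Y t k - Amap P k (wmean \<gamma> ?Y t 0) - bvec P k)
      = (\<Sum>i=1..t. weight i * (w k \<bullet> (?Y i k - Amap P k (?Y i 0) - bvec P k)))"
    if k: "k \<in> {1..Knum P}" for k
  proof -
    have "linear (Amap P k)" using linear_A k by simp
    then have "Amap P k (wmean \<gamma> ?Y t 0) = (\<Sum>i=1..t. weight i *\<^sub>R Amap P k (?Y i 0))"
      unfolding wmean_eq by (simp add: linear_sum linear_scale)
    moreover have "w k \<bullet> bvec P k = (\<Sum>i=1..t. weight i * (w k \<bullet> bvec P k))"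
      by (rule weighted_const[symmetric])
    ultimately show ?thesis
      unfolding wmean_eq[of ?Y]
      by (simp add: inner_diff_right inner_sum_right right_diff_distrib sum_subtractf)
  qed
  have "Phi P (x1_part (approx_sol \<gamma> y t)) x2 =
      (\<Sum>k\<le>Knum P. phi P k (wmean \<gamma> ?Y t k) (fst (zs k)) + wmean \<gamma> ?T t k - snd (zs k)) +
      (\<Sum>k=1..Knum P. rho P k * (w k \<bullet> (wmean \<gamma> ?Y t k - Amap P k (wmean \<gamma> ?Y t 0) - bvec P k)))"
    unfolding Phi_def x2f approx_sol_def by simp
  also have "\<dots> \<le>
      (\<Sum>k\<le>Knum P. \<Sum>i=1..t. weight i * (phi P k (?Y i k) (fst (zs k)) + ?T i k - snd (zs k))) +
      (\<Sum>k=1..Knum P. \<Sum>i=1..t. weight i * (rho P k * (w k \<bullet> (?Y i k - Amap P k (?Y i 0) - bvec P k))))"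
    by (intro add_mono sum_mono) (use phi coupling in \<open>auto simp: sum_distrib_left mult.left_commute\<close>)
  also have "\<dots> = (\<Sum>i=1..t. weight i * Phi P (x1_part (y i)) x2)"
    unfolding Phi_def x2f x1_part_eq
    by (subst (1 2) sum.swap) (simp add: sum.distrib[symmetric] sum_distrib_left distrib_left)
  finally show ?thesis .
qed

lemma Phi_approx_sol_right:
  assumes x1: "x1 \<in> X1 P"
  shows "(\<Sum>i=1..t. weight i * Phi P x1 (x2_part (y i))) \<le> Phi P x1 (x2_part (approx_sol \<gamma> y t))"
proof -
  let ?Z = "\<lambda>i. fst (snd (fst (y i)))" and ?W = "\<lambda>i. snd (snd (fst (y i)))" and ?S = "\<lambda>i. snd (snd (y i))"
  let ?d = "\<lambda>k. fst (x1 k) - Amap P k (fst (x1 0)) - bvec P k"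
  have phi: "(\<Sum>i=1..t. weight i * (phi P k (fst (x1 k)) (?Z i k) + snd (x1 k) - ?S i k))
      \<le> phi P k (fst (x1 k)) (wmean \<gamma> ?Z t k) + snd (x1 k) - wmean \<gamma> ?S t k"
    if k: "k \<le> Knum P" for k
  proof -
    have "fst (x1 k) \<in> Yset P k"
      using x1 k by (simp add: X1_iff)
    then have "- phi P k (fst (x1 k)) (wmean \<gamma> ?Z t k) \<le> (\<Sum>i=1..t. weight i * - phi P k (fst (x1 k)) (?Z i k))"
      using iterate_components(2)[OF _ k] phi_concave[OF k] unfolding concave_on_def
      by (intro convex_on_wmean[of "Zset P k" "\<lambda>v. - phi P k (fst (x1 k)) v"]) auto
    moreover have "snd (x1 k) = (\<Sum>i=1..t. weight i * snd (x1 k))"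
      by (rule weighted_const[symmetric])
    ultimately show ?thesis
      unfolding wmean_eq[of ?S]
      by (simp add: distrib_left right_diff_distrib sum.distrib sum_subtractf sum_negf)
  qed
  have "(\<Sum>i=1..t. weight i * Phi P x1 (x2_part (y i))) =
      (\<Sum>k\<le>Knum P. \<Sum>i=1..t. weight i * (phi P k (fst (x1 k)) (?Z i k) + snd (x1 k) - ?S i k)) +
      (\<Sum>k=1..Knum P. \<Sum>i=1..t. weight i * (rho P k * (?W i k \<bullet> ?d k)))"
    unfolding Phi_def x2_part_eq
    by (subst (1 2) sum.swap) (simp add: sum.distrib[symmetric] sum_distrib_left distrib_left)
  also have "\<dots> \<le>
      (\<Sum>k\<le>Knum P. phi P k (fst (x1 k)) (wmean \<gamma> ?Z t k) + snd (x1 k) - wmean \<gamma> ?S t k) +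
      (\<Sum>k=1..Knum P. rho P k * (wmean \<gamma> ?W t k \<bullet> ?d k))"
    by (intro add_mono sum_mono)
      (use phi in \<open>auto simp: wmean_eq inner_sum_left sum_distrib_left mult.left_commute\<close>)
  also have "\<dots> = Phi P x1 (x2_part (approx_sol \<gamma> y t))"
    unfolding Phi_def approx_sol_def by simp
  finally show ?thesis .
qed

end

section \<open>Exact penalization\<close>

lemma affine_in_Y:
  assumes "assm_B1 P" "k \<le> Knum P" "y \<in> Yset P 0"
  shows "Amap P k y + bvec P k \<in> Yset P k"
proof (cases "k = 0")
  case True
  then show ?thesis using A0_identity[of y] Y_subset[of 0] assms(3) by auto
next
  case False
  then show ?thesis using assms unfolding assm_B1_def by auto
qed

lemma correction_in_X1:
  assumes "assm_B1 P" "fst (x1 0) \<in> Yset P 0"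
  shows "correction P x1 \<in> X1 P"
  using affine_in_Y[OF assms(1) _ assms(2)] assms(2)
  by (auto simp: X1_iff correction_def Let_def)

lemma Phi_correction_le_fobj:
  assumes y0: "fst (x1 0) \<in> Yset P 0" and B1: "assm_B1 P" and x2: "x2 \<in> X2 P"
  shows "Phi P (correction P x1) x2 \<le> fobj P (fst (x1 0))"
proof -
  obtain zs w where x2f: "x2 = (zs, w)" by (cases x2)
  let ?y = "\<lambda>k. Amap P k (fst (x1 0)) + bvec P k"
  have y: "fst (correction P x1 k) = ?y k" "snd (correction P x1 k) = PsiY P k (?y k)" for k
    using A0_identity[of "fst (x1 0)"] Y_subset[of 0] y0 by (auto simp: correction_def Let_def)
  have "phi P k (?y k) (fst (zs k)) - snd (zs k) \<le> psi P k (?y k)" if k: "k \<le> Knum P" for k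
  proof -
    have z: "fst (zs k) \<in> Zset P k" "PsiZ P k (fst (zs k)) \<le> snd (zs k)"
      using x2 k unfolding x2f by (auto simp: X2_iff)
    have "ereal (phi P k (?y k) (fst (zs k)) - PsiZ P k (fst (zs k))) \<le> ereal (psi P k (?y k))"
      using psi_SUP[OF k] affine_in_Y[OF B1 k y0] z(1)
      by (auto intro!: SUP_upper simp del: ereal_less_eq)
    then show ?thesis using z(2) by simp
  qed
  note phi = this
  have "?y 0 = fst (x1 0)" using A0_identity[of "fst (x1 0)"] Y_subset[of 0] y0 by auto
  then have "Phi P (correction P x1) x2
      = (\<Sum>k\<le>Knum P. phi P k (?y k) (fst (zs k)) + PsiY P k (?y k) - snd (zs k))"
    unfolding Phi_def x2f fst_conv snd_conv y by simp
  also have "\<dots> \<le> fobj P (fst (x1 0))"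
    unfolding fobj_def using phi by (intro sum_mono) (auto simp: algebra_simps)
  finally show ?thesis .
qed

text \<open>Maximizing \<open>\<rho>\<^sub>k \<langle>w, d\<^sub>k\<rangle>\<close> over \<open>W\<^sub>k\<close> gives \<open>\<rho>\<^sub>k \<pi>\<^sub>k\<^sup>*(d\<^sub>k)\<close>, and with \<open>\<rho>\<^sub>k \<ge> G\<^sub>k + H\<^sub>k\<close> this pays for moving
  the argument of the \<open>k\<close>-th term from \<open>y\<^sup>k\<close> to \<open>A\<^sub>k y\<^sup>0 + b\<^sub>k = y\<^sup>k - d\<^sub>k\<close>. The suprema over \<open>z\<^sup>k\<close> and \<open>w\<^sup>k\<close> are
  approximated to within \<open>e'\<close>, and the errors add up to \<open>e\<close>.\<close>

lemma Phi_ge_fobj: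
  assumes B1: "assm_B1 P" and C: "assm_C P G H" and rho: "\<forall>k\<in>{1..Knum P}. G k + H k \<le> rho P k"
    and x1: "x1 \<in> X1 P" and e: "0 < e"
  obtains x2 where "x2 \<in> X2 P" "fobj P (fst (x1 0)) - e \<le> Phi P x1 x2"
proof -
  \<comment> \<open>\<open>c\<close> counts each error \<open>e'\<close> in \<open>z\<^sup>k\<close> once and each in \<open>w\<^sup>k\<close> with its factor \<open>\<rho>\<^sub>k\<close>.\<close>
  define c where "c = real (Knum P + 1) + (\<Sum>k=1..Knum P. rho P k)"
  have c: "0 < c" unfolding c_def using rho_pos by (intro add_pos_nonneg sum_nonneg) (auto simp: less_imp_le)
  define e' where "e' = e / c"
  have e': "0 < e'" unfolding e'_def using e c by simp
  define y where "y k = fst (x1 k)" for k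
  define \<tau> where "\<tau> k = snd (x1 k)" for k
  define d where "d k = y k - Amap P k (y 0) - bvec P k" for k
  have y: "\<And>k. k \<le> Knum P \<Longrightarrow> y k \<in> Yset P k" "\<And>k. k \<le> Knum P \<Longrightarrow> PsiY P k (y k) \<le> \<tau> k"
    using x1 unfolding X1_iff y_def \<tau>_def by auto
  have Ay: "Amap P k (y 0) + bvec P k \<in> Yset P k" if "k \<le> Knum P" for k
    using affine_in_Y[OF B1 that] y(1)[of 0] by simp
  have d_alt: "d k = y k - (Amap P k (y 0) + bvec P k)" for k unfolding d_def by simp
  have d: "d k \<in> Esp P k" if "k \<le> Knum P" for k
    unfolding d_alt using y(1)[OF that] Ay[OF that] Y_subset[OF that] subspace_diff[OF subspace_E[OF that]] by blast
  have "\<exists>z. z \<in> Zset P k \<and> psi P k (y k) - e' < phi P k (y k) z - PsiZ P k z" if k: "k \<le> Knum P" for k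
  proof -
    have "ereal (psi P k (y k) - e') < ereal (psi P k (y k))" using e' by simp
    also have "\<dots> = (SUP z\<in>Zset P k. ereal (phi P k (y k) z - PsiZ P k z))" using psi_SUP[OF k] y(1)[OF k] by blast
    finally show ?thesis unfolding less_SUP_iff by auto
  qed
  then obtain z where z: "\<And>k. k \<le> Knum P \<Longrightarrow> z k \<in> Zset P k"
    "\<And>k. k \<le> Knum P \<Longrightarrow> psi P k (y k) - e' < phi P k (y k) (z k) - PsiZ P k (z k)"
    by metis
  have "\<exists>w. w \<in> Wset P k \<and> pistar P k (d k) - e' < w \<bullet> d k" if k: "k \<in> {1..Knum P}" for k
    using conj_norm_dual_witness[OF subspace_E pistar[OF k] d, of "pistar P k (d k) - e'"] k e'
    unfolding Wset_def pinorm_def by auto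
  then obtain w where w: "\<And>k. k \<in> {1..Knum P} \<Longrightarrow> w k \<in> Wset P k"
    "\<And>k. k \<in> {1..Knum P} \<Longrightarrow> pistar P k (d k) - e' < w k \<bullet> d k"
    by metis
  let ?F = "\<lambda>k v. psi P k v + PsiY P k v"
  have move: "?F k (Amap P k (y 0) + bvec P k) \<le> ?F k (y k) + rho P k * pistar P k (d k)"
    if k: "k \<in> {1..Knum P}" for k
  proof -
    have *: "\<bar>psi P k (y k) - psi P k (Amap P k (y 0) + bvec P k)\<bar> \<le> G k * pistar P k (d k)"
      "\<bar>PsiY P k (y k) - PsiY P k (Amap P k (y 0) + bvec P k)\<bar> \<le> H k * pistar P k (d k)"
      using C k y(1)[of k] Ay[of k] unfolding assm_C_def d_alt by auto
    have "(G k + H k) * pistar P k (d k) \<le> rho P k * pistar P k (d k)"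
      using rho k norm_on_nonneg[OF pistar[OF k] d] by (intro mult_right_mono) auto
    then show ?thesis using * by (simp add: distrib_right)
  qed
  have A0: "Amap P 0 (y 0) + bvec P 0 = y 0"
    using A0_identity[of "y 0"] y(1)[of 0] Y_subset[of 0] by auto
  have "fobj P (y 0) \<le> ?F 0 (y 0) + (\<Sum>k=1..Knum P. ?F k (y k) + rho P k * pistar P k (d k))"
    unfolding fobj_def sum_atMost_eq_head[of _ "Knum P"] A0 using move by (intro add_left_mono sum_mono) auto
  also have "\<dots> = (\<Sum>k\<le>Knum P. ?F k (y k)) + (\<Sum>k=1..Knum P. rho P k * pistar P k (d k))"
    unfolding sum_atMost_eq_head[of _ "Knum P"] by (simp add: sum.distrib)
  also have "\<dots> \<le> (\<Sum>k\<le>Knum P. phi P k (y k) (z k) + \<tau> k - PsiZ P k (z k) + e')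
      + (\<Sum>k=1..Knum P. rho P k * (w k \<bullet> d k) + rho P k * e')"
  proof (rule add_mono; rule sum_mono)
    show "?F k (y k) \<le> phi P k (y k) (z k) + \<tau> k - PsiZ P k (z k) + e'" if "k \<in> {..Knum P}" for k
      using z(2)[of k] y(2)[of k] that by simp
    show "rho P k * pistar P k (d k) \<le> rho P k * (w k \<bullet> d k) + rho P k * e'" if k: "k \<in> {1..Knum P}" for k
      using mult_left_mono[of "pistar P k (d k)" "w k \<bullet> d k + e'" "rho P k"] w(2)[OF k] rho_pos[OF k]
      by (simp add: distrib_left)
  qed
  also have "\<dots> = Phi P x1 (\<lambda>k. (z k, PsiZ P k (z k)), w) + c * e'"
    unfolding Phi_def c_def y_def[symmetric] \<tau>_def[symmetric] d_def
    by (simp add: sum.distrib sum_distrib_right distrib_right)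
  finally have "fobj P (fst (x1 0)) - e \<le> Phi P x1 (\<lambda>k. (z k, PsiZ P k (z k)), w)"
    using c unfolding e'_def y_def by simp
  moreover have "(\<lambda>k. (z k, PsiZ P k (z k)), w) \<in> X2 P"
    using z(1) w(1) by (simp add: X2_iff)
  ultimately show thesis using that by blast
qed

lemma PhiBar_correction_le_fobj:
  assumes "fst (x1 0) \<in> Yset P 0" "assm_B1 P"
  shows "PhiBar P (correction P x1) \<le> ereal (fobj P (fst (x1 0)))"
  unfolding PhiBar_def using Phi_correction_le_fobj[of x1, OF assms] by (intro SUP_least) simp

lemma fobj_le_PhiBar:
  assumes "assm_B1 P" "assm_C P G H" "\<forall>k\<in>{1..Knum P}. G k + H k \<le> rho P k" "x1 \<in> X1 P"
  shows "ereal (fobj P (fst (x1 0))) \<le> PhiBar P x1"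
proof (rule ereal_le_epsilon2)
  fix e :: real assume "0 < e"
  then obtain x2 where x2: "x2 \<in> X2 P" "fobj P (fst (x1 0)) - e \<le> Phi P x1 x2"
    using Phi_ge_fobj[OF assms] by blast
  have "ereal (fobj P (fst (x1 0))) \<le> ereal (Phi P x1 x2) + ereal e" using x2(2) by simp
  also have "\<dots> \<le> PhiBar P x1 + ereal e"
    unfolding PhiBar_def using x2(1) by (intro add_right_mono SUP_upper)
  finally show "ereal (fobj P (fst (x1 0))) \<le> PhiBar P x1 + ereal e" .
qed

section \<open>Existence of minimizers\<close>

lemma term_continuous:
  assumes "k \<le> Knum P"
  shows "continuous_on (Yset P k) (\<lambda>y. psi P k y + PsiY P k y)"
  using psi_lipschitz[OF assms] PsiY_lipschitz[OF assms]
  by (auto intro!: continuous_on_add intro: lipschitz_on_continuous_on)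

lemma term_coercive:
  assumes B2: "assm_B2 P" and k: "k \<le> Knum P"
    and s: "\<forall>i. s i \<in> Yset P k" "filterlim (\<lambda>i. norm (s i)) at_top sequentially"
  shows "filterlim (\<lambda>i. psi P k (s i) + PsiY P k (s i)) at_top sequentially"
proof -
  obtain C where C: "0 < C" "\<And>x. x \<in> Esp P k \<Longrightarrow> norm x \<le> C * pnorm P k x"
    using norm_le_norm_on[OF subspace_E[OF k] pnorm[OF k]] by blast
  have "filterlim (\<lambda>i. inverse C * norm (s i)) at_top sequentially"
    using C(1) s(2) by (intro filterlim_tendsto_pos_mult_at_top[OF tendsto_const]) auto
  then have "filterlim (\<lambda>i. pnorm P k (s i)) at_top sequentially"
  proof (rule filterlim_at_top_mono)
    show "\<forall>\<^sub>F i in sequentially. inverse C * norm (s i) \<le> pnorm P k (s i)"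
      using C s(1) Y_subset[OF k] by (intro always_eventually allI) (auto simp: field_simps)
  qed
  then show ?thesis using B2 k s(1) unfolding assm_B2_def by blast
qed

lemma fobj_attains_inf:
  assumes B1: "assm_B1 P" and B2: "assm_B2 P"
  obtains c where "c \<in> Yset P 0" "\<And>y. y \<in> Yset P 0 \<Longrightarrow> fobj P c \<le> fobj P y"
proof -
  let ?F = "\<lambda>k v. psi P k v + PsiY P k v"
  have "\<exists>m. \<forall>v\<in>Yset P k. m \<le> ?F k v" if k: "k \<le> Knum P" for k
    using coercive_attains_inf[OF closed_Y[OF k] Y_nonempty[OF k] term_continuous[OF k] term_coercive[OF B2 k]]
    by metis
  then obtain m where m: "\<And>k v. k \<le> Knum P \<Longrightarrow> v \<in> Yset P k \<Longrightarrow> m k \<le> ?F k v" by metis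
  have "continuous_on (Yset P 0) (fobj P)"
    unfolding fobj_def
  proof (intro continuous_on_sum)
    fix k assume "k \<in> {..Knum P}"
    then have k: "k \<le> Knum P" by simp
    have "continuous_on (Yset P 0) (\<lambda>y. Amap P k y + bvec P k)"
      using linear_continuous_on[OF linear_conv_bounded_linear[THEN iffD1, OF linear_A[OF k]]]
      by (intro continuous_intros)
    then show "continuous_on (Yset P 0) (\<lambda>y. ?F k (Amap P k y + bvec P k))"
      using affine_in_Y[OF B1 k] by (intro continuous_on_compose2[OF term_continuous[OF k]]) auto
  qed
  moreover have "filterlim (\<lambda>i. fobj P (s i)) at_top sequentially"
    if s: "\<forall>i. s i \<in> Yset P 0" "filterlim (\<lambda>i. norm (s i)) at_top sequentially" for s :: "nat \<Rightarrow> 'a"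
  proof -
    have le: "(\<Sum>k=1..Knum P. m k) + ?F 0 y \<le> fobj P y" if y: "y \<in> Yset P 0" for y
    proof -
      have "(\<Sum>k=1..Knum P. m k) \<le> (\<Sum>k=1..Knum P. ?F k (Amap P k y + bvec P k))"
        using m affine_in_Y[OF B1 _ y] by (intro sum_mono) auto
      moreover have "Amap P 0 y + bvec P 0 = y" using A0_identity[of y] Y_subset[of 0] y by auto
      ultimately show ?thesis unfolding fobj_def sum_atMost_eq_head[of _ "Knum P"] by simp
    qed
    have "filterlim (\<lambda>i. (\<Sum>k=1..Knum P. m k) + ?F 0 (s i)) at_top sequentially"
      using term_coercive[OF B2 _ s] by (intro filterlim_tendsto_add_at_top[OF tendsto_const]) simp
    then show ?thesis
      by (rule filterlim_at_top_mono) (use le s(1) in \<open>auto intro: always_eventually\<close>)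
  qed
  ultimately show thesis
    using coercive_attains_inf[OF closed_Y Y_nonempty, of 0 "fobj P"] that by blast
qed

text \<open>A minimizer of \<open>f\<close>, lifted by the correction, is a minimizer of the saddle point reformulation,
  because the correction of any \<open>x\<^sup>1\<close> does not increase the primal function.\<close>

lemma PhiBar_attains_inf:
  assumes B1: "assm_B1 P" and B2: "assm_B2 P" and C: "assm_C P G H"
    and rho: "\<forall>k\<in>{1..Knum P}. G k + H k \<le> rho P k"
  shows "\<exists>x1s. is_arg_min (PhiBar P) (\<lambda>x1. x1 \<in> X1 P) x1s"
proof -
  obtain c where c: "c \<in> Yset P 0" "\<And>y. y \<in> Yset P 0 \<Longrightarrow> fobj P c \<le> fobj P y"
    using fobj_attains_inf[OF B1 B2] by blast
  let ?x = "correction P (\<lambda>_. (c, 0))"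
  have "PhiBar P ?x \<le> PhiBar P x1" if x1: "x1 \<in> X1 P" for x1
  proof -
    have "PhiBar P ?x \<le> ereal (fobj P c)"
      using PhiBar_correction_le_fobj[of "\<lambda>_. (c, 0)"] c(1) B1 by simp
    also have "\<dots> \<le> ereal (fobj P (fst (x1 0)))" using c(2) x1 by (simp add: X1_iff)
    also have "\<dots> \<le> PhiBar P x1" by (rule fobj_le_PhiBar[OF B1 C rho x1])
    finally show ?thesis .
  qed
  moreover have "?x \<in> X1 P" using correction_in_X1[OF B1, of "\<lambda>_. (c, 0)"] c(1) by simp
  ultimately show ?thesis unfolding is_arg_min_def by (meson not_le)
qed

section \<open>The efficiency estimate\<close>

text \<open>The averaged gap is at most \<open>V / \<Gamma>\<close> with \<open>\<Gamma>\<close> the sum of the stepsizes. As \<open>V\<close> is nonnegative,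
  \<open>\<Gamma> \<ge> t / L\<close> turns this into \<open>V L / t\<close>.\<close>

lemma saddle_gap_estimate:
  assumes mp: "mirror_prox P \<gamma> x y" and \<delta>: "\<forall>i\<ge>1. delta P \<gamma> x y i \<le> 0"
    and L: "0 < L" and \<gamma>: "\<forall>i\<ge>1. 1 / L \<le> \<gamma> i" and t: "1 \<le> t" and s: "s \<in> Xset P"
  shows "approx_sol \<gamma> y t \<in> Xset P"
    and "Phi P (x1_part (approx_sol \<gamma> y t)) (x2_part s) - Phi P (x1_part s) (x2_part (approx_sol \<gamma> y t))
      \<le> Vdist P (fst (x 1)) (fst s) * L / real t"
proof -
  let ?\<Gamma> = "\<Sum>i=1..t. \<gamma> i"
  have pos: "0 \<le> \<gamma> i" if "i \<in> {1..t}" for i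
    using \<gamma> that L by (intro order_trans[of 0 "1 / L" "\<gamma> i"]) auto
  have yX: "y i \<in> Xset P" if "i \<in> {1..t}" for i using mirror_prox_in_Xset(2)[OF mp] that by simp
  have "(\<Sum>i=1..t. 1 / L) \<le> ?\<Gamma>" using \<gamma> by (intro sum_mono) auto
  then have \<Gamma>_ge: "real t / L \<le> ?\<Gamma>" by simp
  moreover have tL: "0 < real t / L" using t L by simp
  ultimately have total: "0 < ?\<Gamma>" by linarith
  show "approx_sol \<gamma> y t \<in> Xset P"
    by (rule approx_sol_in_Xset[OF yX pos total])
  note x1 = Xset_parts(1)[OF s] and x2 = Xset_parts(2)[OF s]
  have "Phi P (x1_part (approx_sol \<gamma> y t)) (x2_part s) - Phi P (x1_part s) (x2_part (approx_sol \<gamma> y t))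
      \<le> (\<Sum>i=1..t. \<gamma> i / ?\<Gamma> * Phi P (x1_part (y i)) (x2_part s))
        - (\<Sum>i=1..t. \<gamma> i / ?\<Gamma> * Phi P (x1_part s) (x2_part (y i)))"
    by (intro diff_mono Phi_approx_sol_left[OF yX pos total x2] Phi_approx_sol_right[OF yX pos total x1])
  also have "\<dots> = (\<Sum>i=1..t. \<gamma> i / ?\<Gamma> * (Phi P (x1_part (y i)) (x2_part s) - Phi P (x1_part s) (x2_part (y i))))"
    by (simp only: right_diff_distrib sum_subtractf)
  also have "\<dots> \<le> (\<Sum>i=1..t. \<gamma> i / ?\<Gamma> * oper_gap (y i) s)"
    using pos total by (intro sum_mono mult_left_mono Phi_gap_le_oper_gap yX s divide_nonneg_nonneg) auto
  also have "\<dots> = (\<Sum>i=1..t. \<gamma> i * oper_gap (y i) s) / ?\<Gamma>"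
    by (simp only: sum_divide_distrib times_divide_eq_left)
  also have "\<dots> \<le> Vdist P (fst (x 1)) (fst s) / ?\<Gamma>"
    using mirror_prox_regret[OF mp \<delta> s, of t] total by (intro divide_right_mono) auto
  also have "\<dots> \<le> Vdist P (fst (x 1)) (fst s) / (real t / L)"
    using mirror_prox_in_Xset(1)[OF mp, of 1] s \<Gamma>_ge tL total
    by (intro divide_left_mono Vdist_nonneg Xset_Uset mult_pos_pos) auto
  finally show "Phi P (x1_part (approx_sol \<gamma> y t)) (x2_part s) - Phi P (x1_part s) (x2_part (approx_sol \<gamma> y t))
      \<le> Vdist P (fst (x 1)) (fst s) * L / real t"
    by simp
qed

text \<open>The gap is evaluated at \<open>(x\<^sup>1\<^sub>*, x\<^sup>2)\<close>, where \<open>x\<^sup>2\<close> nearly realizes exact penalization at the averaged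
  point. On the other side, the value at \<open>x\<^sup>1\<^sub>*\<close> is at most the primal function there, hence at most
  \<open>f(v)\<close> for every feasible \<open>v\<close>. Comparing with every \<open>v\<close> bounds the accuracy
  relative to the infimum of \<open>f\<close>.\<close>

lemma accuracy_estimate:
  assumes B1: "assm_B1 P" and C: "assm_C P G H" and rho: "\<forall>k\<in>{1..Knum P}. G k + H k \<le> rho P k"
    and mp: "mirror_prox P \<gamma> x y" and \<delta>: "\<forall>i\<ge>1. delta P \<gamma> x y i \<le> 0"
    and L: "0 < L" and \<gamma>: "\<forall>i\<ge>1. 1 / L \<le> \<gamma> i" and t: "1 \<le> t"
    and x1s: "is_arg_min (PhiBar P) (\<lambda>x1. x1 \<in> X1 P) x1s"
  shows "ereal (fobj P (fst (x1_part (approx_sol \<gamma> y t) 0))) - Opt P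
    \<le> Theta P (fst (x 1)) (regroup ` ({x1s} \<times> X2 P)) * ereal L / ereal (real t)"
proof -
  let ?xt = "approx_sol \<gamma> y t"
  let ?f = "fobj P (fst (x1_part ?xt 0))"
  let ?T = "Theta P (fst (x 1)) (regroup ` ({x1s} \<times> X2 P)) * ereal L / ereal (real t)"
  have x1sX: "x1s \<in> X1 P" and min: "\<And>x1. x1 \<in> X1 P \<Longrightarrow> PhiBar P x1s \<le> PhiBar P x1"
    using x1s unfolding is_arg_min_def by (auto simp: not_less)
  have "?xt \<in> Xset P"
    using saddle_gap_estimate(1)[OF mp \<delta> L \<gamma> t] mirror_prox_in_Xset(1)[OF mp, of 1] by simp
  note xtX = Xset_parts[OF this]
  have le: "ereal (?f - e) \<le> ?T + ereal (fobj P v)" if e: "0 < e" and v: "v \<in> Yset P 0" for e v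
  proof -
    obtain x2 where x2: "x2 \<in> X2 P" "?f - e \<le> Phi P (x1_part ?xt) x2"
      using Phi_ge_fobj[OF B1 C rho xtX(1) e] by blast
    let ?s = "regroup (x1s, x2)"
    note s = regroup_in_Xset[OF x1sX x2(1)]
    have "ereal (Phi P x1s (x2_part ?xt)) \<le> PhiBar P x1s"
      unfolding PhiBar_def using xtX(2) by (rule SUP_upper)
    also have "\<dots> \<le> PhiBar P (correction P (\<lambda>_. (v, 0)))"
      using v by (intro min correction_in_X1[OF B1]) simp
    also have "\<dots> \<le> ereal (fobj P v)"
      using PhiBar_correction_le_fobj[of "\<lambda>_. (v, 0)"] v B1 by simp
    finally have "Phi P x1s (x2_part ?xt) \<le> fobj P v" by simp
    then have "?f - e \<le> Vdist P (fst (x 1)) (fst ?s) * L / real t + fobj P v"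
      using saddle_gap_estimate(2)[OF mp \<delta> L \<gamma> t s(1)] x2(2) unfolding s(2,3) by linarith
    then have "ereal (?f - e) \<le> ereal (Vdist P (fst (x 1)) (fst ?s) * L / real t) + ereal (fobj P v)"
      by simp
    also have "ereal (Vdist P (fst (x 1)) (fst ?s) * L / real t)
        = ereal (Vdist P (fst (x 1)) (fst ?s)) * ereal L / ereal (real t)"
      using t by simp
    also have "\<dots> \<le> ?T"
    proof (intro ereal_divide_right_mono ereal_mult_right_mono)
      show "ereal (Vdist P (fst (x 1)) (fst ?s)) \<le> Theta P (fst (x 1)) (regroup ` ({x1s} \<times> X2 P))"
        unfolding Theta_def using x2(1)
        by (intro SUP_upper2[of ?s]) (auto split: prod.splits)
    qed (use L t in auto)
    finally show ?thesis by (simp add: add_right_mono)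
  qed
  obtain v0 where v0: "v0 \<in> Yset P 0" using Y_nonempty[of 0] by blast
  show ?thesis
  proof (cases ?T)
    case (real r)
    have "?f - r \<le> fobj P v" if v: "v \<in> Yset P 0" for v
    proof (rule field_le_epsilon)
      fix e :: real assume "0 < e"
      from le[OF this v] show "?f - r \<le> fobj P v + e" unfolding real by simp
    qed
    then have "ereal (?f - r) \<le> Opt P"
      unfolding Opt_def by (intro INF_greatest) simp
    then show ?thesis unfolding real by (cases "Opt P") auto
  next
    case MInf
    then show ?thesis using le[OF zero_less_one v0] by simp
  qed simp
qed

end

theorem mainTheorem4:
  fixes P :: "('a::euclidean_space, 'b::euclidean_space) mt_data"
    and G H :: "nat \<Rightarrow> real"
    and L :: real
    and \<gamma> :: "nat \<Rightarrow> real"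
    and x y :: "nat \<Rightarrow> ('a, 'b) xpoint"
  assumes "mt_setting P" and "assm_B1 P" and "assm_B2 P" and "assm_C P G H"
    and "\<forall>k\<in>{1..Knum P}. G k + H k \<le> rho P k"
    and "0 < L" and "Fu_lipschitz P L"
    and "mirror_prox P \<gamma> x y"
    and "\<forall>i\<ge>1. 1 / L \<le> \<gamma> i"
  shows
    "(\<exists>x1s. is_arg_min (PhiBar P) (\<lambda>x1. x1 \<in> X1 P) x1s) \<and>
     ((\<forall>i\<ge>1. \<gamma> i = 1 / L) \<longrightarrow> (\<forall>i\<ge>1. delta P \<gamma> x y i \<le> 0)) \<and>
     ((\<forall>i\<ge>1. delta P \<gamma> x y i \<le> 0) \<longrightarrow>
        (\<forall>t\<ge>1.
           let yhat = fst (correction P (x1_part (approx_sol \<gamma> y t)) 0)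
           in yhat \<in> Yset P 0 \<and>
              (\<forall>x1s. is_arg_min (PhiBar P) (\<lambda>x1. x1 \<in> X1 P) x1s \<longrightarrow>
                 ereal (fobj P yhat) - Opt P
                   \<le> Theta P (fst (x 1)) (regroup ` ({x1s} \<times> X2 P)) * ereal L / ereal (real t))))"
proof -
  interpret mt_problem P by unfold_locales (rule assms(1))
  have feasible: "fst (x1_part (approx_sol \<gamma> y t) 0) \<in> Yset P 0"
    if "\<forall>i\<ge>1. delta P \<gamma> x y i \<le> 0" "1 \<le> t" for t
    using Xset_parts(1)[OF saddle_gap_estimate(1)[OF assms(8) that(1) assms(6,9) that(2)
          mirror_prox_in_Xset(1)[OF assms(8) order_refl]]]
    by (simp add: X1_iff)
  have corr: "fst (correction P x1 0) = fst (x1 0)" for x1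
    by (simp add: correction_def Let_def)
  show ?thesis
    unfolding corr Let_def
    using PhiBar_attains_inf[OF assms(2-5)] delta_nonpos[OF assms(8,6,7)] feasible
      accuracy_estimate[OF assms(2,4,5,8) _ assms(6,9)]
    by blast
qed

end
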